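(* Let $d_0=(-4,0)$, $e_0=(4,0)$ and let $K\subseteq\mathbb R^2$ be the compact set $$K=\big([-4,4]\times\{0\}\big)\cup\big(\{-6,0\}\times[-6,6]\big)\cup\big([-6,0]\times\{-6,6\}\big)\cup\big(\{-2,2\}\times[-4,4]\big)\cup\big([-2,2]\times\{-4,4\}\big).$$ Define $f:\mathbb R^2\to[0,\infty)$ by $$f(p)=\max\{0,\ 1-d_\infty(p,K),\ 3-3d_\infty(p,d_0),\ 3-3d_\infty(p,e_0)\}.$$ Then $\mathbf{ucat}^\infty(f)=2$ and $\mathbf{ucat}(f)=3$. (In particular, $f$ is a counterexample to the conjecture that $\mathbf{ucat}^{p_1}(f)\le\mathbf{ucat}^{p_2}(f)$ for all $0<p_1<p_2\le\infty$.)
   Context: A continuous function $u:X\to[0,\infty)$ on a topological space is unimodal if there is $M>0$ such that the superlevel set $u^{-1}[c,\infty)$ is contractible for $0<c\le M$ and empty for $c>M$. The unimodal category $\mathbf{ucat}(f)$ of $f:X\to[0,\infty)$ is the minimum number $n$ of unimodal functions $u_1,\dots,u_n:X\to[0,\infty)$ such that pointwise $f=\sum_{i=1}^n u_i$; the unimodal $\infty$-category $\mathbf{ucat}^\infty(f)$ is the minimum number $n$ of unimodal functions such that pointwise $f=\max_{1\le i\le n}u_i$. More generally, for $p\in(0,\infty)$, $\mathbf{ucat}^p(f)$ is defined in the same way using $f=\left(\sum_{i=1}^n u_i^p\right)^{1/p}$. $d_\infty$ denotes the distance on $\mathbb R^2$ induced by the max-norm $\|(x,y)\|_\infty=\max\{|x|,|y|\}$,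 and $d_\infty(p,K)=\inf_{k\in K}d_\infty(p,k)$. *)

theory Defs
  imports "HOL-Analysis.Analysis"
begin

text \<open>
  Functions to $[0,\infty)$ are represented as real-valued functions with a nonnegativity condition.
  The library predicate \<^const>\<open>contractible\<close> holds for the empty set, whereas a
  contractible space is by convention nonempty; hence the explicit nonemptiness below.
\<close>

definition unimodal :: "('a::topological_space \<Rightarrow> real) \<Rightarrow> bool" where
  "unimodal u \<longleftrightarrow>
     continuous_on UNIV u \<and> (\<forall>x. 0 \<le> u x) \<and>
     (\<exists>M>0. (\<forall>c. 0 < c \<and> c \<le> M \<longrightarrow> u -` {c..} \<noteq> {} \<and> contractible (u -` {c..})) \<and>
            (\<forall>c>M. u -` {c..} = {}))"

text \<open>The minimum number of functions is \<^term>\<open>\<infinity>\<close> if no finite decomposition exists.\<close>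

definition ucat :: "('a::topological_space \<Rightarrow> real) \<Rightarrow> enat" where
  "ucat f = Inf {enat n | n. \<exists>u. (\<forall>i\<in>{1..n}. unimodal (u i)) \<and> (\<forall>x. f x = (\<Sum>i=1..n. u i x))}"

definition ucat_pow :: "real \<Rightarrow> ('a::topological_space \<Rightarrow> real) \<Rightarrow> enat" where
  "ucat_pow p f =
     Inf {enat n | n. \<exists>u. (\<forall>i\<in>{1..n}. unimodal (u i)) \<and>
                          (\<forall>x. f x = (\<Sum>i=1..n. u i x powr p) powr (1 / p))}"

text \<open>Inserting 0 fixes the maximum of the empty family to be 0, matching the empty sum; it has
  no effect for \<open>n \<ge> 1\<close>, because unimodal functions are nonnegative.\<close>

definition ucat_infty :: "('a::topological_space \<Rightarrow> real) \<Rightarrow> enat" where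
  "ucat_infty f =
     Inf {enat n | n. \<exists>u. (\<forall>i\<in>{1..n}. unimodal (u i)) \<and>
                          (\<forall>x. f x = Max (insert 0 ((\<lambda>i. u i x) ` {1..n})))}"

text \<open>The unimodal \<open>p\<close>-category for an extended exponent \<open>0 < p \<le> \<infinity>\<close>.\<close>

definition ucat_ext :: "ereal \<Rightarrow> ('a::topological_space \<Rightarrow> real) \<Rightarrow> enat" where
  "ucat_ext p f = (if p = \<infinity> then ucat_infty f else ucat_pow (real_of_ereal p) f)"

text \<open>The type \<^typ>\<open>real \<times> real\<close> carries the Euclidean \<^const>\<open>dist\<close>, so the
  max-norm distances are introduced separately.\<close>

lemma infnorm_Pair: "infnorm (x, y) = max \<bar>x\<bar> \<bar>y\<bar>" for x y :: real
proof -
  have "(\<lambda>b. \<bar>(x, y) \<bullet> b\<bar>) ` Basis = {\<bar>x\<bar>, \<bar>y\<bar>}"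
    by (auto simp: Basis_prod_def)
  then show ?thesis
    by (simp add: infnorm_Max)
qed

definition d_inf :: "real \<times> real \<Rightarrow> real \<times> real \<Rightarrow> real" where
  "d_inf p q = infnorm (p - q)"

definition setdist_inf :: "real \<times> real \<Rightarrow> (real \<times> real) set \<Rightarrow> real" where
  "setdist_inf p K = (INF k\<in>K. d_inf p k)"

definition d0 :: "real \<times> real" where "d0 = (-4, 0)"

definition e0 :: "real \<times> real" where "e0 = (4, 0)"

definition K_set :: "(real \<times> real) set" where
  "K_set = ({-4..4} \<times> {0}) \<union> ({-6, 0} \<times> {-6..6}) \<union> ({-6..0} \<times> {-6, 6}) \<union>
           ({-2, 2} \<times> {-4..4}) \<union> ({-2..2} \<times> {-4, 4})"

definition f_ex :: "real \<times> real \<Rightarrow> real" where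
  "f_ex p = Max {0, 1 - setdist_inf p K_set, 3 - 3 * d_inf p d0, 3 - 3 * d_inf p e0}"

end

theory Submission
  imports Defs
begin

text \<open>
  The function is a ridge landscape over the graph \<^const>\<open>K_set\<close>: it has height 1 along the graph,
  falls off linearly to 0 at distance 1, and carries two peaks of height 3 at the two leaves
  \<open>(-4, 0)\<close> and \<open>(4, 0)\<close>. The leaves are joined to the graph by short edges ending at
  \<open>W = (-2, 0)\<close> and \<open>E = (2, 0)\<close>. The other branch points are \<open>N = (0, 4)\<close>, \<open>S = (0, -4)\<close> and
  \<open>O = (0, 0)\<close>; apart from the long arc \<open>L\<close> from \<open>N\<close> to \<open>S\<close> around the left, the graph is the
  rectangle \<open>N E S W\<close> with its two axes through \<open>O\<close>.

  \<^bold>\<open>Two summands are not enough.\<close> Suppose that the function is \<open>u + v\<close> with \<open>u\<close>, \<open>v\<close> unimodal.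
  Contractible compact subsets of the plane do not separate it. Along a cycle of the graph that
  bounds a hole, \<open>u + v = 1\<close>; if \<open>u\<close> stayed below some \<open>c < 1\<close> there, the compact contractible
  set \<open>{v \<ge> 1 - c}\<close> would contain the cycle and miss a point in the hole, which the cycle separates
  from infinity. So \<open>A = {u \<ge> 1}\<close> and likewise \<open>B = {v \<ge> 1}\<close> meet every such cycle
  (\<open>frontier_meets_superlevel\<close>). Both are connected subsets of the graph with two small squares added around the leaves, and they do not
  share a branch point, because the function is 1 there. A single summand cannot exceed 1 at both
  leaves, so say that \<open>A\<close> contains the left leaf and \<open>B\<close> the right one. To reach any cycle at
  all, \<open>A\<close> passes \<open>W\<close> and \<open>B\<close> passes \<open>E\<close>. To reach the outer cycle \<open>L N E S\<close> without \<open>E\<close>, the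
  set \<open>A\<close> needs \<open>N\<close> or \<open>S\<close>; by the cycle \<open>L N W S\<close> the same holds for \<open>B\<close>. To reach the triangles
  \<open>O E N\<close> and \<open>O E S\<close> without \<open>E\<close>, the set \<open>A\<close> needs \<open>O\<close> or both of \<open>N\<close>, \<open>S\<close>, and likewise
  \<open>B\<close> with \<open>W\<close> in place of \<open>E\<close>. Disjointness on \<open>N\<close>, \<open>S\<close>, \<open>O\<close> makes this impossible
  (\<open>summand_passes\<close>, \<open>no_unimodal_pair\<close>).

  \<^bold>\<open>Decompositions.\<close> For the maximum, the graph is covered by two trees, each with one of the
  leaves, in which segments that are not adjacent are at distance at least 2; thickening such a tree
  by less than 1 leaves it contractible. For the sum, the branch points are divided into \<open>{E, N}\<close>,
  \<open>{W, S}\<close> and \<open>{O}\<close>, and the graph is stacked in three layers accordingly; each layer contributes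
  only what rises above the previous ones, which turns a ridge ending at an earlier layer into a
  tapered ridge. All superlevel sets are finite unions of convex sets arranged along a tree, so
  they are absolute retracts (\<open>peaked_attach\<close>).

  The failure of monotonicity is the comparison of \<open>p = 1\<close> with \<open>p = \<infinity>\<close>.
\<close>

section \<open>Ridges and spikes\<close>

text \<open>
  For a nonempty box \<open>{a..b} \<times> {l..h}\<close>, this is one minus the max-norm distance to the box. As a
  minimum of affine functions it is visibly concave, and its positivity is a conjunction of linear
  inequalities.
\<close>

definition ridge :: "real \<Rightarrow> real \<Rightarrow> real \<Rightarrow> real \<Rightarrow> real \<times> real \<Rightarrow> real" where
  "ridge a b l h p =
     min 1 (min (min (fst p - a + 1) (b + 1 - fst p)) (min (snd p - l + 1) (h + 1 - snd p)))"

definition spike :: "real \<Rightarrow> real \<times> real \<Rightarrow> real" where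
  "spike a p = 3 - 3 * max \<bar>fst p - a\<bar> \<bar>snd p\<bar>"

lemma ridge_le_1: "ridge a b l h p \<le> 1"
  by (simp add: ridge_def)

lemma ridge_eq_1:
  assumes "a \<le> fst p" "fst p \<le> b" "l \<le> snd p" "snd p \<le> h"
  shows "ridge a b l h p = 1"
  using assms by (simp add: ridge_def min_def)

lemma ridge_ge_1: "1 \<le> ridge a b l h p \<longleftrightarrow> p \<in> {a..b} \<times> {l..h}"
  unfolding ridge_def min.bounded_iff mem_Times_iff by auto

lemma spike_ge: "c \<le> spike a p \<longleftrightarrow> \<bar>fst p - a\<bar> \<le> 1 - c / 3 \<and> \<bar>snd p\<bar> \<le> 1 - c / 3"
proof -
  have "c \<le> 3 - 3 * t \<longleftrightarrow> t \<le> 1 - c / 3" for t :: real by linarith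
  then show ?thesis by (simp only: spike_def max.bounded_iff)
qed

lemma spike_greater: "c < spike a p \<longleftrightarrow> \<bar>fst p - a\<bar> < 1 - c / 3 \<and> \<bar>snd p\<bar> < 1 - c / 3"
proof -
  have "c < 3 - 3 * t \<longleftrightarrow> t < 1 - c / 3" for t :: real by linarith
  then show ?thesis by (simp only: spike_def max_less_iff_conj)
qed

lemma spike_le_0: "spike a p \<le> 0 \<longleftrightarrow> ridge a a 0 0 p \<le> 0"
  unfolding spike_def ridge_def min_le_iff_disj by (auto simp: max_def abs_if not_le)

text \<open>
  Statements about vertical ridges, and about left ends, follow from those about right ends of
  horizontal ridges by symmetry.
\<close>

lemma ridge_swap: "ridge a b l h p = ridge l h a b (prod.swap p)"
  unfolding ridge_def by (simp only: fst_swap snd_swap) (metis min.commute)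

lemma ridge_reflect: "ridge a b l h (- fst p, snd p) = ridge (- b) (- a) l h p"
proof -
  have "- fst p - a + 1 = - a + 1 - fst p" "b + 1 - - fst p = fst p - - b + 1" by simp_all
  then show ?thesis
    unfolding ridge_def fst_conv snd_conv by (simp only: min.commute)
qed

lemma ridge_split_horizontal:
  assumes "a \<le> m" "m \<le> b"
  shows "ridge a b l h p = max (ridge a m l h p) (ridge m b l h p)"
proof (rule order.antisym)
  show "max (ridge a m l h p) (ridge m b l h p) \<le> ridge a b l h p"
    using assms by (auto simp: ridge_def min_le_iff_disj)
  show "ridge a b l h p \<le> max (ridge a m l h p) (ridge m b l h p)"
  proof (cases "fst p \<le> m")
    case True
    then have "ridge a b l h p \<le> ridge a m l h p"
      by (auto simp: ridge_def min_le_iff_disj)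
    then show ?thesis by linarith
  next
    case False
    then have "ridge a b l h p \<le> ridge m b l h p"
      by (auto simp: ridge_def min_le_iff_disj)
    then show ?thesis by linarith
  qed
qed

lemma ridge_split_vertical:
  assumes "l \<le> m" "m \<le> h"
  shows "ridge a b l h p = max (ridge a b l m p) (ridge a b m h p)"
  using ridge_split_horizontal[OF assms] by (simp only: ridge_swap[of a b])

lemma d_inf_Pair: "d_inf p (a, b) = max \<bar>fst p - a\<bar> \<bar>snd p - b\<bar>"
  by (cases p) (simp add: d_inf_def infnorm_Pair)

lemma setdist_inf_box:
  assumes "a \<le> b" "l \<le> h"
  shows "1 - setdist_inf p ({a..b} \<times> {l..h}) = ridge a b l h p"
proof -
  obtain x y where p: "p = (x, y)" by force
  let ?m = "max 0 (max (max (a - x) (x - b)) (max (l - y) (y - h)))"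
  let ?q = "(max a (min b x), max l (min h y))"
  have dist: "setdist_inf p ({a..b} \<times> {l..h}) = ?m"
    unfolding setdist_inf_def
  proof (rule cInf_eq_minimum)
    have "?q \<in> {a..b} \<times> {l..h}" using assms by auto
    have clamp: "\<bar>t - max i (min j t)\<bar> = max 0 (max (i - t) (t - j))" if "i \<le> j"
      for i j t :: real
      using that by linarith
    have "d_inf p ?q = ?m"
      unfolding p d_inf_Pair fst_conv snd_conv clamp[OF assms(1)] clamp[OF assms(2)]
      by (simp only: max.assoc max.left_commute max.idem max.left_idem)
    with \<open>?q \<in> _\<close> show "?m \<in> d_inf p ` ({a..b} \<times> {l..h})" by (metis image_eqI)
  next
    fix z assume "z \<in> d_inf p ` ({a..b} \<times> {l..h})"
    then obtain u v where "z = d_inf p (u, v)" "u \<in> {a..b}" "v \<in> {l..h}" by auto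
    then show "?m \<le> z" unfolding p by (auto simp: d_inf_Pair le_max_iff_disj)
  qed
  have minus_max: "1 - max u v = min (1 - u) (1 - v)" for u v :: real by linarith
  have "1 - ?m = min (1 - 0) (min (min (1 - (a - x)) (1 - (x - b))) (min (1 - (l - y)) (1 - (y - h))))"
    by (simp only: minus_max)
  also have "\<dots> = ridge a b l h p"
    unfolding ridge_def p fst_conv snd_conv by (intro arg_cong2[where f = min]) simp_all
  finally show ?thesis
    by (simp only: dist)
qed

lemma setdist_inf_box_Un:
  assumes "a \<le> b" "l \<le> h" "B \<noteq> {}"
  shows "1 - setdist_inf p ({a..b} \<times> {l..h} \<union> B) = max (ridge a b l h p) (1 - setdist_inf p B)"
proof -
  have "bdd_below (d_inf p ` C)" for C
    by (rule bdd_belowI[of _ 0]) (auto simp: d_inf_def infnorm_pos_le)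
  then have "setdist_inf p ({a..b} \<times> {l..h} \<union> B)
      = min (setdist_inf p ({a..b} \<times> {l..h})) (setdist_inf p B)"
    unfolding setdist_inf_def using assms by (simp add: cINF_union inf_min)
  then show ?thesis
    unfolding setdist_inf_box[OF assms(1,2), symmetric] by linarith
qed

lemma K_set_boxes:
  "K_set = {-4..4} \<times> {0..0} \<union> ({-6..-6} \<times> {-6..6} \<union> ({0..0} \<times> {-6..6} \<union> ({-6..0} \<times> {-6..-6} \<union>
     ({-6..0} \<times> {6..6} \<union> ({-2..-2} \<times> {-4..4} \<union> ({2..2} \<times> {-4..4} \<union>
     ({-2..2} \<times> {-4..-4} \<union> {-2..2} \<times> {4..4})))))))"
proof -
  have "{a, b} \<times> C = {a..a} \<times> C \<union> {b..b} \<times> C" "C \<times> {a, b} = C \<times> {a..a} \<union> C \<times> {b..b}"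
    for a b :: real and C :: "real set" by auto
  then show ?thesis unfolding K_set_def by (simp only: Un_assoc atLeastAtMost_singleton)
qed

text \<open>
  The distance to a union is the minimum of the distances, so the function is a maximum of one
  ridge per segment of the graph and the two spikes.
\<close>

lemma f_ex_ridges:
  "f_ex p = max 0 (max (spike (-4) p) (max (spike 4 p) (max (ridge (-4) 4 0 0 p)
     (max (ridge (-6) (-6) (-6) 6 p) (max (ridge 0 0 (-6) 6 p) (max (ridge (-6) 0 (-6) (-6) p)
     (max (ridge (-6) 0 6 6 p) (max (ridge (-2) (-2) (-4) 4 p) (max (ridge 2 2 (-4) 4 p)
     (max (ridge (-2) 2 (-4) (-4) p) (ridge (-2) 2 4 4 p)))))))))))"
proof -
  have K: "1 - setdist_inf p K_set = max (ridge (-4) 4 0 0 p)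
     (max (ridge (-6) (-6) (-6) 6 p) (max (ridge 0 0 (-6) 6 p) (max (ridge (-6) 0 (-6) (-6) p)
     (max (ridge (-6) 0 6 6 p) (max (ridge (-2) (-2) (-4) 4 p) (max (ridge 2 2 (-4) 4 p)
     (max (ridge (-2) 2 (-4) (-4) p) (ridge (-2) 2 4 4 p))))))))"
    unfolding K_set_boxes
    by (intro trans[OF setdist_inf_box_Un] arg_cong2[where f = max] refl setdist_inf_box) auto
  have Max4: "Max {0, a, b, c} = max 0 (max b (max c a))" for a b c :: real by simp
  have S: "3 - 3 * d_inf p d0 = spike (-4) p" "3 - 3 * d_inf p e0 = spike 4 p"
    unfolding d0_def e0_def spike_def d_inf_Pair by (simp_all only: diff_0_right)
  show ?thesis
    unfolding f_ex_def S K Max4 by (rule refl)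
qed

section \<open>Functions whose superlevel sets are absolute retracts\<close>

text \<open>
  An absolute retract is contractible, but unlike contractibility the property passes to a union of
  two closed sets with an intersection of the same kind. This makes it the invariant for adding
  pieces one by one.
\<close>

definition peaked :: "real \<Rightarrow> (real \<times> real \<Rightarrow> real) \<Rightarrow> bool" where
  "peaked M u \<longleftrightarrow> continuous_on UNIV u \<and> (\<forall>x. u x \<le> M) \<and>
     (\<forall>c. 0 < c \<and> c \<le> M \<longrightarrow> AR {x. c \<le> u x})"

text \<open>
  Closed under minima, so it covers ridges, spikes and tapered ridges alike.
\<close>

definition quasiconcave :: "(real \<times> real \<Rightarrow> real) \<Rightarrow> bool" where
  "quasiconcave w \<longleftrightarrow> continuous_on UNIV w \<and> (\<forall>c. convex {x. c \<le> w x})"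

lemma peaked_imp_unimodal:
  assumes "peaked M u" "0 < M"
  shows "unimodal (\<lambda>x. max 0 (u x))"
proof -
  have eq: "(\<lambda>x. max 0 (u x)) -` {c..} = {x. c \<le> u x}" if "0 < c" for c
    using that by auto
  have "continuous_on UNIV (\<lambda>x. max 0 (u x))"
    using assms by (auto simp: peaked_def intro!: continuous_intros)
  moreover have "{x. c \<le> u x} \<noteq> {} \<and> contractible {x. c \<le> u x}" if "0 < c" "c \<le> M" for c
    using assms that unfolding peaked_def by (metis AR_imp_contractible not_AR_empty)
  moreover have "{x. c \<le> u x} = {}" if "M < c" for c
    using assms that by (auto simp: peaked_def not_le intro: le_less_trans)
  ultimately show ?thesis
    unfolding unimodal_def using \<open>0 < M\<close> by (intro conjI exI[of _ M]) (simp_all add: eq)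
qed

lemma peaked_quasiconcave:
  assumes "quasiconcave w" "\<And>x. w x \<le> M" "M \<le> w z"
  shows "peaked M w"
  unfolding peaked_def
proof (intro conjI allI impI convex_imp_AR)
  fix c assume "0 < c \<and> c \<le> M"
  then have "z \<in> {x. c \<le> w x}" using assms(3) by simp
  then show "{x. c \<le> w x} \<noteq> {}" by blast
qed (use assms in \<open>simp_all only: quasiconcave_def\<close>)

lemma quasiconcave_min:
  "quasiconcave v \<Longrightarrow> quasiconcave w \<Longrightarrow> quasiconcave (\<lambda>x. min (v x) (w x))"
  unfolding quasiconcave_def
  by (auto intro!: continuous_intros simp: Collect_conj_eq convex_Int)

lemma quasiconcave_affine: "quasiconcave (\<lambda>p. k + (v \<bullet> p))"
proof -
  have "{p. c \<le> k + (v \<bullet> p)} = {p. v \<bullet> p \<ge> c - k}" for c by auto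
  then show ?thesis
    unfolding quasiconcave_def by (auto intro!: continuous_intros convex_halfspace_ge)
qed

lemma quasiconcave_linear: "quasiconcave (\<lambda>p. k + (a * fst p + b * snd p))"
  using quasiconcave_affine[of k "(a, b)"] by (simp add: inner_prod_def)

lemma quasiconcave_const: "quasiconcave (\<lambda>p. k)"
  using quasiconcave_linear[of k 0 0] by simp

lemma quasiconcave_ridge: "quasiconcave (ridge a b l h)"
proof -
  have "ridge a b l h = (\<lambda>p. min 1 (min (min ((1 - a) + (1 * fst p + 0 * snd p)) ((1 + b) + ((-1) * fst p + 0 * snd p)))
     (min ((1 - l) + (0 * fst p + 1 * snd p)) ((1 + h) + (0 * fst p + (-1) * snd p)))))"
    unfolding ridge_def by (intro ext arg_cong2[where f = min]) simp_all
  then show ?thesis by (simp only: quasiconcave_min quasiconcave_linear quasiconcave_const)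
qed

lemma quasiconcave_spike: "quasiconcave (spike a)"
proof -
  have "spike a = (\<lambda>p. min (min ((3 + 3 * a) + ((-3) * fst p + 0 * snd p)) ((3 - 3 * a) + (3 * fst p + 0 * snd p)))
     (min (3 + (0 * fst p + (-3) * snd p)) (3 + (0 * fst p + 3 * snd p))))"
  proof (rule ext)
    fix p
    have "3 - 3 * max \<bar>t\<bar> \<bar>s\<bar> = min (min (3 - 3 * t) (3 + 3 * t)) (min (3 - 3 * s) (3 + 3 * s))"
      for t s :: real by (simp add: max_def min_def abs_if)
    from this[of "fst p - a" "snd p"]
    show "spike a p = min (min ((3 + 3 * a) + ((-3) * fst p + 0 * snd p)) ((3 - 3 * a) + (3 * fst p + 0 * snd p)))
     (min (3 + (0 * fst p + (-3) * snd p)) (3 + (0 * fst p + 3 * snd p)))"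
      by (simp add: spike_def algebra_simps)
  qed
  then show ?thesis by (simp only: quasiconcave_min quasiconcave_linear)
qed

text \<open>
  The minimum with a slant tapers a ridge along \<open>y = m\<close> or \<open>x = m\<close>: within distance 1 of the zero of
  the affine part, its height on the axis falls linearly to 0.
\<close>

definition slant_x :: "real \<Rightarrow> real \<Rightarrow> real \<Rightarrow> real \<times> real \<Rightarrow> real" where
  "slant_x s k m p = s * fst p + k - \<bar>snd p - m\<bar>"

definition slant_y :: "real \<Rightarrow> real \<Rightarrow> real \<Rightarrow> real \<times> real \<Rightarrow> real" where
  "slant_y s k m p = s * snd p + k - \<bar>fst p - m\<bar>"

lemma quasiconcave_slant_x: "quasiconcave (slant_x s k m)"
proof -
  have "slant_x s k m = (\<lambda>p. min ((k + m) + (s * fst p + (-1) * snd p)) ((k - m) + (s * fst p + 1 * snd p)))"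
    by (auto simp: slant_x_def fun_eq_iff)
  then show ?thesis by (simp only: quasiconcave_min quasiconcave_linear)
qed

lemma quasiconcave_slant_y: "quasiconcave (slant_y s k m)"
proof -
  have "slant_y s k m = (\<lambda>p. min ((k + m) + ((-1) * fst p + s * snd p)) ((k - m) + (1 * fst p + s * snd p)))"
    by (auto simp: slant_y_def fun_eq_iff)
  then show ?thesis by (simp only: quasiconcave_min quasiconcave_linear)
qed

lemmas quasiconcave_intros = quasiconcave_min quasiconcave_slant_x quasiconcave_slant_y
  quasiconcave_ridge quasiconcave_spike

lemma peaked_spike: "peaked 3 (spike a)"
  by (rule peaked_quasiconcave[OF quasiconcave_spike, of _ _ "(a, 0)"]) (auto simp: spike_def)

text \<open>
  Only positive parts are compared, here and below, since unimodality concerns positive levels.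
\<close>

definition apart :: "(real \<times> real \<Rightarrow> real) \<Rightarrow> (real \<times> real \<Rightarrow> real) \<Rightarrow> bool" where
  "apart u w \<longleftrightarrow> (\<forall>p. u p \<le> 0 \<or> w p \<le> 0)"

text \<open>
  In other words, above level 0 the overlap of \<open>u\<close> and \<open>w\<close> lies below \<open>v\<close>.
\<close>

definition meets_within ::
    "(real \<times> real \<Rightarrow> real) \<Rightarrow> (real \<times> real \<Rightarrow> real) \<Rightarrow> (real \<times> real \<Rightarrow> real) \<Rightarrow> bool" where
  "meets_within v u w \<longleftrightarrow> (\<forall>p. u p \<le> max 0 (v p) \<or> w p \<le> max 0 (v p))"

text \<open>
  One step of building along a tree: a new piece \<open>w\<close> may be added to \<open>u\<close> if it overlaps
  with \<open>u\<close> only inside one parent piece \<open>v\<close>. At a positive level the intersection of the two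
  superlevel sets is then that of \<open>v\<close> and \<open>w\<close>, which is convex; the common summit \<open>z\<close>
  guarantees that it is nonempty whenever both sets are.
\<close>

lemma peaked_attach:
  assumes u: "peaked M u" and "N \<le> M" and v: "quasiconcave v" and w: "quasiconcave w"
    and w_le: "\<And>p. w p \<le> N" and z: "N \<le> v z" "N \<le> w z"
    and vu: "\<And>p. v p \<le> u p" and meet: "meets_within v u w"
  shows "peaked M (\<lambda>p. max (u p) (w p))"
  unfolding peaked_def
proof (intro conjI allI impI)
  have W: "peaked N w" using w w_le z(2) by (rule peaked_quasiconcave)
  show "continuous_on UNIV (\<lambda>p. max (u p) (w p))"
    using u W by (auto simp: peaked_def intro!: continuous_intros)
  show "max (u p) (w p) \<le> M" for p
  proof (rule max.boundedI)
    show "u p \<le> M" using u unfolding peaked_def by blast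
    show "w p \<le> M" using w_le[of p] \<open>N \<le> M\<close> by (rule order.trans)
  qed
  fix c :: real assume c: "0 < c \<and> c \<le> M"
  have split: "{p. c \<le> max (u p) (w p)} = {p. c \<le> u p} \<union> {p. c \<le> w p}" by auto
  show "AR {p. c \<le> max (u p) (w p)}"
  proof (cases "c \<le> N")
    case True
    have clo: "closed {p. c \<le> g p}" if "continuous_on UNIV g" for g :: "real \<times> real \<Rightarrow> real"
      using that by (intro closed_Collect_le) auto
    have "c \<le> min (v z) (w z)" using True z by linarith
    then have ne: "{p. c \<le> min (v p) (w p)} \<noteq> {}" by blast
    \<comment> \<open>above level 0, the overlap of \<open>u\<close> and \<open>w\<close> is that of \<open>v\<close> and \<open>w\<close>\<close>
    have "{p. c \<le> u p} \<inter> {p. c \<le> w p} = {p. c \<le> min (v p) (w p)}"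
    proof (intro subset_antisym subsetI)
      fix p assume "p \<in> {p. c \<le> u p} \<inter> {p. c \<le> w p}"
      moreover have "u p \<le> max 0 (v p) \<or> w p \<le> max 0 (v p)" using meet unfolding meets_within_def by blast
      ultimately show "p \<in> {p. c \<le> min (v p) (w p)}" using c by auto
    next
      fix p assume "p \<in> {p. c \<le> min (v p) (w p)}"
      then show "p \<in> {p. c \<le> u p} \<inter> {p. c \<le> w p}" using vu[of p] by auto
    qed
    moreover have "AR {p. c \<le> min (v p) (w p)}"
      using quasiconcave_min[OF v w] ne unfolding quasiconcave_def by (blast intro: convex_imp_AR)
    ultimately show ?thesis
      unfolding split using u W c True
      by (intro AR_closed_Un) (auto simp: peaked_def intro: clo closed_subset)
  next
    case False
    then have "{p. c \<le> w p} = {}" using w_le by (force dest: le_less_trans)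
    then have "{p. c \<le> max (u p) (w p)} = {p. c \<le> u p}" unfolding split by blast
    then show ?thesis using u c unfolding peaked_def by metis
  qed
qed

section \<open>How ridges meet\<close>

text \<open>
  A ridge reaches less than 1 beyond its box, so boxes at distance 2 are enough. This is why gaps of
  length 2 in the graph survive all thickenings.
\<close>

lemma apart_ridge_ridge:
  assumes "b + 2 \<le> a' \<or> b' + 2 \<le> a \<or> h + 2 \<le> l' \<or> h' + 2 \<le> l"
  shows "apart (ridge a b l h) (ridge a' b' l' h')"
  using assms unfolding apart_def ridge_def min_le_iff_disj by (auto simp: not_le)

lemma apart_spike_ridge: "apart (ridge a a 0 0) w \<Longrightarrow> apart (spike a) w"
  by (simp add: apart_def spike_le_0)

lemma apart_ridge_spike: "apart u (ridge a a 0 0) \<Longrightarrow> apart u (spike a)"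
  by (simp add: apart_def spike_le_0)

lemma apart_min_left: "apart u w \<Longrightarrow> apart (\<lambda>p. min (u p) (t p)) w"
  unfolding apart_def by (meson min.coboundedI1)

lemma apart_min_right: "apart u w \<Longrightarrow> apart u (\<lambda>p. min (w p) (t p))"
  unfolding apart_def by (meson min.coboundedI1)

lemma apart_max: "apart u w \<Longrightarrow> apart u' w \<Longrightarrow> apart (\<lambda>p. max (u p) (u' p)) w"
  unfolding apart_def by (meson max.boundedI)

lemma meets_within_refl: "meets_within v v w"
  by (simp add: meets_within_def)

lemma meets_within_apart: "apart u w \<Longrightarrow> meets_within v u w"
  unfolding apart_def meets_within_def by (meson max.coboundedI1)

lemma meets_within_max:
  assumes "meets_within v u w" "meets_within v u' w"
  shows "meets_within v (\<lambda>p. max (u p) (u' p)) w"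
  unfolding meets_within_def
proof
  fix p
  show "max (u p) (u' p) \<le> max 0 (v p) \<or> w p \<le> max 0 (v p)"
    using assms unfolding meets_within_def by (meson max.boundedI)
qed

lemma meets_within_min_left: "meets_within v u w \<Longrightarrow> meets_within v (\<lambda>p. min (u p) (t p)) w"
  unfolding meets_within_def by (meson min.coboundedI1)

lemma meets_within_min_right: "meets_within v u w \<Longrightarrow> meets_within v u (\<lambda>p. min (w p) (t p))"
  unfolding meets_within_def by (meson min.coboundedI1)

lemma meets_within_commute: "meets_within v u w \<longleftrightarrow> meets_within v w u"
  unfolding meets_within_def by blast

lemma meets_within_compose:
  "meets_within v u w \<Longrightarrow> meets_within (\<lambda>p. v (g p)) (\<lambda>p. u (g p)) (\<lambda>p. w (g p))"
  unfolding meets_within_def by blast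

text \<open>
  This serves ridges that start at a common point, no two of which are apart.
\<close>

lemma meets_within_ridge_Int:
  assumes "a'' = max a a'" "b'' = min b b'" "l'' = max l l'" "h'' = min h h'"
  shows "meets_within (ridge a'' b'' l'' h'') (ridge a b l h) (ridge a' b' l' h')"
  unfolding meets_within_def
proof
  fix p :: "real \<times> real"
  define t where "t = min (ridge a b l h p) (ridge a' b' l' h' p)"
  have t: "t \<le> 1" "t \<le> fst p - a + 1" "t \<le> fst p - a' + 1" "t \<le> b + 1 - fst p" "t \<le> b' + 1 - fst p"
    "t \<le> snd p - l + 1" "t \<le> snd p - l' + 1" "t \<le> h + 1 - snd p" "t \<le> h' + 1 - snd p"
    unfolding t_def ridge_def min_le_iff_disj by simp_all
  have "t \<le> fst p - a'' + 1" using t(2,3) assms(1) by linarith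
  moreover have "t \<le> b'' + 1 - fst p" using t(4,5) assms(2) by linarith
  moreover have "t \<le> snd p - l'' + 1" using t(6,7) assms(3) by linarith
  moreover have "t \<le> h'' + 1 - snd p" using t(8,9) assms(4) by linarith
  ultimately have "t \<le> ridge a'' b'' l'' h'' p" using t(1) by (simp only: ridge_def min.bounded_iff simp_thms)
  then have "min (ridge a b l h p) (ridge a' b' l' h' p) \<le> ridge a'' b'' l'' h'' p" by (simp only: t_def)
  then show "ridge a b l h p \<le> max 0 (ridge a'' b'' l'' h'' p) \<or>
      ridge a' b' l' h' p \<le> max 0 (ridge a'' b'' l'' h'' p)"
    by linarith
qed

text \<open>
  For \<open>x \<ge> c\<close> the ridge ending at \<open>c\<close> is below the transversal one; for \<open>x \<le> c\<close> the ridge starting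
  there is.
\<close>

lemma meets_within_across:
  assumes "l \<le> m" "m \<le> h"
  shows "meets_within (ridge c c l h) (ridge c d m m) (ridge a c m m)"
  unfolding meets_within_def
proof
  fix p :: "real \<times> real"
  consider "c \<le> fst p" | "fst p \<le> c" by linarith
  then show "ridge c d m m p \<le> max 0 (ridge c c l h p) \<or> ridge a c m m p \<le> max 0 (ridge c c l h p)"
  proof cases
    case 1
    then have "ridge a c m m p \<le> ridge c c l h p"
      unfolding ridge_def using assms by (intro min.boundedI) (simp_all add: min_le_iff_disj)
    then show ?thesis by linarith
  next
    case 2
    then have "ridge c d m m p \<le> ridge c c l h p"
      unfolding ridge_def using assms by (intro min.boundedI) (simp_all add: min_le_iff_disj)
    then show ?thesis by linarith
  qed
qed

lemma meets_within_across_vertical: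
  assumes "l \<le> m" "m \<le> h"
  shows "meets_within (ridge l h c c) (ridge m m c d) (ridge m m a c)"
  using meets_within_compose[where g = prod.swap, OF meets_within_across[OF assms]]
  by (simp add: ridge_swap[symmetric])

lemmas meets_across = meets_within_across meets_within_across_vertical
  meets_within_across[THEN meets_within_commute[THEN iffD1]]
  meets_within_across_vertical[THEN meets_within_commute[THEN iffD1]]

text \<open>
  The rules that discharge the last premise of \<open>peaked_attach\<close>. The order matters: reflexivity comes
  first, so that a parent is never required to be apart from its child.
\<close>

lemmas meets_intros = meets_within_refl meets_within_max meets_within_apart apart_spike_ridge
   apart_ridge_ridge apart_min_left apart_min_right

lemmas piece_intros = order.refl max.cobounded2 ridge_le_1 min.coboundedI1[OF ridge_le_1]
  quasiconcave_intros meets_intros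

section \<open>A maximum of two trees\<close>

text \<open>
  The tree with the left leaf contains the path \<open>N W O E S\<close> and the upper half of the arc
  \<open>L\<close>. The complementary edges \<open>E N\<close>, \<open>N O\<close>, \<open>O S\<close>, \<open>S W\<close> form a path as well; it belongs to the
  other tree, with the lower half of the arc.
\<close>

definition tree_d :: "real \<times> real \<Rightarrow> real" where
  "tree_d p = max (max (max (max (max (max (max (max (spike (-4) p)
     (ridge (-4) 2 0 0 p))
     (ridge (-2) (-2) 0 4 p))
     (ridge (-2) 0 4 4 p))
     (ridge 0 0 4 6 p))
     (ridge (-6) 0 6 6 p))
     (ridge (-6) (-6) 0 6 p))
     (ridge 2 2 (-4) 0 p))
     (ridge 0 2 (-4) (-4) p)"

text \<open>
  Each application attaches the last piece to its parent \<open>v\<close> at the point \<open>z\<close>; the chain unwinds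
  the nested maximum from the outside.
\<close>

lemma peaked_tree_d: "peaked 3 tree_d"
  unfolding tree_d_def[abs_def]
  apply (rule peaked_attach[where v = "ridge 2 2 (-4) 0" and z = "(2, -4)" and N = 1])
  apply (rule peaked_attach[where v = "ridge (-4) 2 0 0" and z = "(2, 0)" and N = 1])
  apply (rule peaked_attach[where v = "ridge (-6) 0 6 6" and z = "(-6, 6)" and N = 1])
  apply (rule peaked_attach[where v = "ridge 0 0 4 6" and z = "(0, 6)" and N = 1])
  apply (rule peaked_attach[where v = "ridge (-2) 0 4 4" and z = "(0, 4)" and N = 1])
  apply (rule peaked_attach[where v = "ridge (-2) (-2) 0 4" and z = "(-2, 4)" and N = 1])
  apply (rule peaked_attach[where v = "ridge (-4) 2 0 0" and z = "(-2, 0)" and N = 1])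
  apply (rule peaked_attach[where v = "spike (-4)" and z = "(-4, 0)" and N = 1])
  apply (rule peaked_spike)
  apply (rule piece_intros
      | rule max.coboundedI1 | simp add: ridge_eq_1 spike_def slant_x_def slant_y_def; fail)+
  done

definition tree_e :: "real \<times> real \<Rightarrow> real" where
  "tree_e p = max (max (max (max (max (max (max (max (spike 4 p)
     (ridge 2 4 0 0 p))
     (ridge 2 2 0 4 p))
     (ridge 0 2 4 4 p))
     (ridge 0 0 (-6) 4 p))
     (ridge (-2) 0 (-4) (-4) p))
     (ridge (-2) (-2) (-4) 0 p))
     (ridge (-6) 0 (-6) (-6) p))
     (ridge (-6) (-6) (-6) 0 p)"

lemma peaked_tree_e: "peaked 3 tree_e"
  unfolding tree_e_def[abs_def]
  apply (rule peaked_attach[where v = "ridge (-6) 0 (-6) (-6)" and z = "(-6, -6)" and N = 1])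
  apply (rule peaked_attach[where v = "ridge 0 0 (-6) 4" and z = "(0, -6)" and N = 1])
  apply (rule peaked_attach[where v = "ridge (-2) 0 (-4) (-4)" and z = "(-2, -4)" and N = 1])
  apply (rule peaked_attach[where v = "ridge 0 0 (-6) 4" and z = "(0, -4)" and N = 1])
  apply (rule peaked_attach[where v = "ridge 0 2 4 4" and z = "(0, 4)" and N = 1])
  apply (rule peaked_attach[where v = "ridge 2 2 0 4" and z = "(2, 4)" and N = 1])
  apply (rule peaked_attach[where v = "ridge 2 4 0 0" and z = "(2, 0)" and N = 1])
  apply (rule peaked_attach[where v = "spike 4" and z = "(4, 0)" and N = 1])
  apply (rule peaked_spike)
  apply (rule piece_intros
      | rule max.coboundedI1 | simp add: ridge_eq_1 spike_def slant_x_def slant_y_def; fail)+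
  done

lemma f_ex_eq_max_trees: "f_ex p = max (max 0 (tree_d p)) (max 0 (tree_e p))"
proof -
  have horizontal: "ridge (-4) 4 0 0 p = max (ridge (-4) 2 0 0 p) (ridge 2 4 0 0 p)"
    "ridge (-2) 2 (-4) (-4) p = max (ridge (-2) 0 (-4) (-4) p) (ridge 0 2 (-4) (-4) p)"
    "ridge (-2) 2 4 4 p = max (ridge (-2) 0 4 4 p) (ridge 0 2 4 4 p)"
    by (intro ridge_split_horizontal; simp)+
  have vertical: "ridge (-6) (-6) (-6) 6 p = max (ridge (-6) (-6) (-6) 0 p) (ridge (-6) (-6) 0 6 p)"
    "ridge 0 0 (-6) 6 p = max (ridge 0 0 (-6) 4 p) (ridge 0 0 4 6 p)"
    "ridge (-2) (-2) (-4) 4 p = max (ridge (-2) (-2) (-4) 0 p) (ridge (-2) (-2) 0 4 p)"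
    "ridge 2 2 (-4) 4 p = max (ridge 2 2 (-4) 0 p) (ridge 2 2 0 4 p)"
    by (intro ridge_split_vertical; simp)+
  show ?thesis
    unfolding f_ex_ridges tree_d_def tree_e_def horizontal vertical
    by (simp only: max.assoc max.commute max.left_commute max.left_idem)
qed

section \<open>What rises above an earlier layer\<close>

text \<open>
  How far \<open>b\<close> rises above \<open>max 0 u\<close>. This is a relation, because \<open>c\<close> matters only where it is
  positive.
\<close>

definition residual ::
    "(real \<times> real \<Rightarrow> real) \<Rightarrow> (real \<times> real \<Rightarrow> real) \<Rightarrow> (real \<times> real \<Rightarrow> real) \<Rightarrow> bool" where
  "residual u b c \<longleftrightarrow> (\<forall>p. max (max 0 (u p)) (b p) - max 0 (u p) = max 0 (c p))"

lemma residual_apart: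
  assumes "apart u b"
  shows "residual u b b"
  unfolding residual_def
proof
  fix p
  have "u p \<le> 0 \<or> b p \<le> 0" using assms unfolding apart_def by blast
  then show "max (max 0 (u p)) (b p) - max 0 (u p) = max 0 (b p)" by linarith
qed

lemma residual_max:
  assumes "residual u b c" "residual u b' c'"
  shows "residual u (\<lambda>p. max (b p) (b' p)) (\<lambda>p. max (c p) (c' p))"
  unfolding residual_def
proof
  fix p
  have "max (max 0 (u p)) (b p) - max 0 (u p) = max 0 (c p)"
    "max (max 0 (u p)) (b' p) - max 0 (u p) = max 0 (c' p)"
    using assms unfolding residual_def by blast+
  then show "max (max 0 (u p)) (max (b p) (b' p)) - max 0 (u p) = max 0 (max (c p) (c' p))"
    by linarith
qed

text \<open>
  The remainder is determined by the only part \<open>r\<close> of \<open>u\<close> that \<open>b\<close> really meets: where \<open>max 0 u\<close>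
  exceeds \<open>max 0 r\<close>, the ridge \<open>b\<close> is already covered by \<open>max 0 r\<close>, and both remainders vanish.
\<close>

lemma residual_transfer:
  assumes "residual r b c" and "\<And>p. r p \<le> u p" and "meets_within r u b"
  shows "residual u b c"
  unfolding residual_def
proof
  fix p
  have "max (max 0 (r p)) (b p) - max 0 (r p) = max 0 (c p)" "r p \<le> u p"
    "u p \<le> max 0 (r p) \<or> b p \<le> max 0 (r p)"
    using assms unfolding residual_def meets_within_def by blast+
  then show "max (max 0 (u p)) (b p) - max 0 (u p) = max 0 (c p)" by linarith
qed

text \<open>
  A horizontal ridge runs into a vertical one at \<open>x = c\<close>. Within distance 1 to the left of this line
  and near the axis, the heights are \<open>1 - \<bar>y - m\<bar>\<close> and \<open>1 - (c - x)\<close>, with difference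
  \<open>c - x - \<bar>y - m\<bar>\<close>. The point of impact may be an end of the vertical ridge, so corners are
  included.
\<close>

lemma residual_right:
  assumes "a + 1 \<le> c" "l \<le> m" "m \<le> h"
  shows "residual (ridge c c l h) (ridge a c m m) (\<lambda>p. min (ridge a c m m p) (slant_x (-1) c m p))"
  unfolding residual_def
proof
  fix p :: "real \<times> real"
  define x y b r s where "x = fst p" and "y = snd p" and "b = ridge a c m m p"
    and "r = ridge c c l h p" and "s = slant_x (-1) c m p"
  have s: "s = c - x - \<bar>y - m\<bar>" by (simp add: s_def slant_x_def x_def y_def)
  have b: "b = min 1 (min (min (x - a + 1) (c + 1 - x)) (min (y - m + 1) (m + 1 - y)))"
    by (simp only: b_def ridge_def x_def y_def)
  have r: "r = min 1 (min (min (x - c + 1) (c + 1 - x)) (min (y - l + 1) (h + 1 - y)))"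
    by (simp only: r_def ridge_def x_def y_def)
  have b_le: "b \<le> 1 - \<bar>y - m\<bar>" "b \<le> c + 1 - x" "b \<le> y - m + 1" "b \<le> m + 1 - y" "b \<le> 1"
    unfolding b by linarith+
  consider "b \<le> 0" | "b \<le> r" "s \<le> 0" | "r \<le> 0" "b \<le> s" | "0 \<le> r" "b - r = s" "0 \<le> s"
  proof -
    show thesis
    proof (cases "s \<le> 0")
      case True
      have "b \<le> r" unfolding r using b_le True s assms by (intro min.boundedI) linarith+
      then show thesis using True that(2) by blast
    next
      case False
      show thesis
      proof (cases "x \<le> c - 1 \<or> b \<le> 0")
        case True
        then show thesis
        proof
          assume "x \<le> c - 1"
          then have "r \<le> 0" "b \<le> s" unfolding r using s b_le(1) by linarith+
          then show thesis by (rule that(3))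
        qed (rule that(1))
      next
        case *: False
        then have "r = x - c + 1" unfolding r using False b_le s assms by linarith
        moreover have "b = 1 - \<bar>y - m\<bar>" unfolding b using False * b_le s assms by linarith
        ultimately show thesis using False * s by (intro that(4)) linarith+
      qed
    qed
  qed
  then have "max (max 0 r) b - max 0 r = max 0 (min b s)" by cases linarith+
  then show "max (max 0 (ridge c c l h p)) (ridge a c m m p) - max 0 (ridge c c l h p)
      = max 0 (min (ridge a c m m p) (slant_x (-1) c m p))"
    by (simp only: b_def r_def s_def)
qed

text \<open>
  This transports the previous lemma by the reflections of the plane.
\<close>

lemma residual_compose:
  "residual u b c \<Longrightarrow> residual (\<lambda>p. u (g p)) (\<lambda>p. b (g p)) (\<lambda>p. c (g p))"
  unfolding residual_def by blast

lemma residual_left: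
  assumes "c + 1 \<le> b" "l \<le> m" "m \<le> h"
  shows "residual (ridge c c l h) (ridge c b m m) (\<lambda>p. min (ridge c b m m p) (slant_x 1 (-c) m p))"
  using residual_compose[OF residual_right[of "-b" "-c" l m h], of "\<lambda>p. (- fst p, snd p)"] assms
  by (simp add: ridge_reflect slant_x_def)

lemma residual_top:
  assumes "a + 1 \<le> c" "l \<le> m" "m \<le> h"
  shows "residual (ridge l h c c) (ridge m m a c) (\<lambda>p. min (ridge m m a c p) (slant_y (-1) c m p))"
  using residual_compose[OF residual_right[OF assms], of prod.swap]
  by (simp add: ridge_swap[symmetric] slant_x_def slant_y_def)

lemma residual_bottom:
  assumes "c + 1 \<le> b" "l \<le> m" "m \<le> h"
  shows "residual (ridge l h c c) (ridge m m c b) (\<lambda>p. min (ridge m m c b p) (slant_y 1 (-c) m p))"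
  using residual_compose[OF residual_left[OF assms], of prod.swap]
  by (simp add: ridge_swap[symmetric] slant_x_def slant_y_def)

section \<open>A sum of three layers\<close>

text \<open>
  The first layer contains the branch points \<open>E\<close> and \<open>N\<close>, the right leaf, and the arc \<open>L\<close> down to
  its lower left corner. As nothing lies below it, its ridges keep their full length.
\<close>

definition layer_e :: "real \<times> real \<Rightarrow> real" where
  "layer_e p = max (max (max (max (max (max (spike 4 p)
     (ridge 2 4 0 0 p))
     (ridge 2 2 (-4) 4 p))
     (ridge (-2) 2 4 4 p))
     (ridge 0 0 4 6 p))
     (ridge (-6) 0 6 6 p))
     (ridge (-6) (-6) (-6) 6 p)"

lemma peaked_layer_e: "peaked 3 layer_e"
  unfolding layer_e_def[abs_def]
  apply (rule peaked_attach[where v = "ridge (-6) 0 6 6" and z = "(-6, 6)" and N = 1])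
  apply (rule peaked_attach[where v = "ridge 0 0 4 6" and z = "(0, 6)" and N = 1])
  apply (rule peaked_attach[where v = "ridge (-2) 2 4 4" and z = "(0, 4)" and N = 1])
  apply (rule peaked_attach[where v = "ridge 2 2 (-4) 4" and z = "(2, 4)" and N = 1])
  apply (rule peaked_attach[where v = "ridge 2 4 0 0" and z = "(2, 0)" and N = 1])
  apply (rule peaked_attach[where v = "spike 4" and z = "(4, 0)" and N = 1])
  apply (rule peaked_spike)
  apply (rule piece_intros
      | rule max.coboundedI1 | simp add: ridge_eq_1 spike_def slant_x_def slant_y_def; fail)+
  done

text \<open>
  The second layer contains \<open>W\<close>, \<open>S\<close>, the left leaf, and the rest of the arc. Three of its ridges run
  into the first layer, on the edges towards \<open>N\<close> and \<open>E\<close> and on the arc, and are tapered there.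
\<close>

definition layer_d :: "real \<times> real \<Rightarrow> real" where
  "layer_d p = max (max (max (max (max (spike (-4) p)
     (ridge (-4) (-2) 0 0 p))
     (min (ridge (-2) (-2) (-4) 4 p) (slant_y (-1) 4 (-2) p)))
     (min (ridge (-2) 2 (-4) (-4) p) (slant_x (-1) 2 (-4) p)))
     (ridge 0 0 (-6) (-4) p))
     (min (ridge (-6) 0 (-6) (-6) p) (slant_x 1 6 (-6) p))"

lemma peaked_layer_d: "peaked 3 layer_d"
  unfolding layer_d_def[abs_def]
  apply (rule peaked_attach[where v = "ridge 0 0 (-6) (-4)" and z = "(0, -6)" and N = 1])
  apply (rule peaked_attach[where v = "\<lambda>p. min (ridge (-2) 2 (-4) (-4) p) (slant_x (-1) 2 (-4) p)"
      and z = "(0, -4)" and N = 1])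
  apply (rule peaked_attach[where v = "\<lambda>p. min (ridge (-2) (-2) (-4) 4 p) (slant_y (-1) 4 (-2) p)"
      and z = "(-2, -4)" and N = 1])
  apply (rule peaked_attach[where v = "ridge (-4) (-2) 0 0" and z = "(-2, 0)" and N = 1])
  apply (rule peaked_attach[where v = "spike (-4)" and z = "(-4, 0)" and N = 1])
  apply (rule peaked_spike)
  apply (rule piece_intros
      | rule max.coboundedI1 | simp add: ridge_eq_1 spike_def slant_x_def slant_y_def; fail)+
  done

text \<open>
  The third layer is a star with four arms around \<open>O\<close>, tapered at \<open>N\<close>, \<open>E\<close>, \<open>S\<close> and \<open>W\<close>. The
  central ridge serves as the common parent of the arms.
\<close>

definition layer_o :: "real \<times> real \<Rightarrow> real" where
  "layer_o p = max (max (max (max (ridge 0 0 0 0 p)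
     (min (ridge 0 2 0 0 p) (slant_x (-1) 2 0 p)))
     (min (ridge (-2) 0 0 0 p) (slant_x 1 2 0 p)))
     (min (ridge 0 0 0 4 p) (slant_y (-1) 4 0 p)))
     (min (ridge 0 0 (-4) 0 p) (slant_y 1 4 0 p))"

lemma peaked_layer_o: "peaked 1 layer_o"
  unfolding layer_o_def[abs_def]
  apply (rule peaked_attach[where v = "ridge 0 0 0 0" and z = "(0, 0)" and N = 1])
  apply (rule peaked_attach[where v = "ridge 0 0 0 0" and z = "(0, 0)" and N = 1])
  apply (rule peaked_attach[where v = "ridge 0 0 0 0" and z = "(0, 0)" and N = 1])
  apply (rule peaked_attach[where v = "ridge 0 0 0 0" and z = "(0, 0)" and N = 1])
  apply (rule peaked_quasiconcave[where z = "(0, 0)"])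
  apply (rule order.refl max.cobounded2 ridge_le_1 min.coboundedI1[OF ridge_le_1] quasiconcave_intros
     meets_within_refl meets_within_max meets_within_min_left meets_within_min_right meets_within_ridge_Int
      | rule max.coboundedI1 | simp add: ridge_eq_1 slant_x_def slant_y_def; fail)+
  done

text \<open>
  The second and the third layer before tapering.
\<close>

definition ridges_d :: "real \<times> real \<Rightarrow> real" where
  "ridges_d p = max (max (max (max (max (spike (-4) p)
     (ridge (-4) (-2) 0 0 p))
     (ridge (-2) (-2) (-4) 4 p))
     (ridge (-2) 2 (-4) (-4) p))
     (ridge 0 0 (-6) (-4) p))
     (ridge (-6) 0 (-6) (-6) p)"

definition ridges_o :: "real \<times> real \<Rightarrow> real" where
  "ridges_o p = max (max (max (max (ridge 0 0 0 0 p) (ridge 0 2 0 0 p)) (ridge (-2) 0 0 0 p))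
     (ridge 0 0 0 4 p)) (ridge 0 0 (-4) 0 p)"

lemma f_ex_eq_max_layers: "f_ex p = max 0 (max (max (layer_e p) (ridges_d p)) (ridges_o p))"
proof -
  have 1: "ridge (-4) 4 0 0 p = max (ridge (-4) (-2) 0 0 p) (ridge (-2) 4 0 0 p)"
    "ridge (-2) 4 0 0 p = max (ridge (-2) 0 0 0 p) (ridge 0 4 0 0 p)"
    "ridge 0 4 0 0 p = max (ridge 0 0 0 0 p) (ridge 0 4 0 0 p)"
    "ridge 0 4 0 0 p = max (ridge 0 2 0 0 p) (ridge 2 4 0 0 p)"
    by (intro ridge_split_horizontal; simp)+
  have 2: "ridge 0 0 (-6) 6 p = max (ridge 0 0 (-6) (-4) p) (ridge 0 0 (-4) 6 p)"
    "ridge 0 0 (-4) 6 p = max (ridge 0 0 (-4) 0 p) (ridge 0 0 0 6 p)"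
    "ridge 0 0 0 6 p = max (ridge 0 0 0 4 p) (ridge 0 0 4 6 p)"
    by (intro ridge_split_vertical; simp)+
  show ?thesis
    unfolding f_ex_ridges layer_e_def ridges_d_def ridges_o_def 1(1) 1(2) 2
    (* a single step, because the central ridge can be split off any number of times *)
    apply (subst 1(3)) unfolding 1(4)
    by (simp only: max.assoc max.commute max.left_commute max.left_idem)
qed

text \<open>
  Ridges apart from the first layer remain as they are. Each of the other three runs into a single
  ridge of that layer, at one of its ends or at a corner.
\<close>

lemma residual_ridges_d: "residual layer_e ridges_d layer_d"
  unfolding layer_e_def[abs_def] ridges_d_def[abs_def] layer_d_def[abs_def]
  apply (intro residual_max)
  apply (rule residual_apart; (rule apart_max apart_ridge_spike piece_intros | simp; fail)+)
  apply (rule residual_apart; (rule apart_max apart_ridge_spike piece_intros | simp; fail)+)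
  apply (rule residual_transfer[OF residual_top[where l = "-2" and h = 2]];
    (rule piece_intros | rule max.coboundedI1 | simp; fail)+)
  apply (rule residual_transfer[OF residual_right[where l = "-4" and h = 4]];
    (rule piece_intros | rule max.coboundedI1 | simp; fail)+)
  apply (rule residual_apart; (rule apart_max apart_ridge_spike piece_intros | simp; fail)+)
  apply (rule residual_transfer[OF residual_left[where c = "-6" and l = "-6" and h = 6, simplified]];
    (rule piece_intros | rule max.coboundedI1 | simp; fail)+)
  done

text \<open>
  Beyond the transversal ridge that an arm runs into, the earlier layers contain a ridge that
  continues the arm; it does not matter for the remainder, by the rules about ridges meeting
  across.
\<close>

lemma residual_ridges_o: "residual (\<lambda>p. max (layer_e p) (ridges_d p)) ridges_o layer_o"
  unfolding layer_e_def[abs_def] ridges_d_def[abs_def] ridges_o_def[abs_def] layer_o_def[abs_def] max.assoc[symmetric]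
  apply (intro residual_max)
  apply (rule residual_apart; (rule apart_max apart_ridge_spike piece_intros | simp; fail)+)
  apply (rule residual_transfer[OF residual_right[where l = "-4" and h = 4]];
    (rule meets_across piece_intros | rule max.coboundedI1 | simp; fail)+)
  apply (rule residual_transfer[OF residual_left[where c = "-2" and l = "-4" and h = 4, simplified]];
    (rule meets_across piece_intros | rule max.coboundedI1 | simp; fail)+)
  apply (rule residual_transfer[OF residual_top[where l = "-2" and h = 2]];
    (rule meets_across piece_intros | rule max.coboundedI1 | simp; fail)+)
  apply (rule residual_transfer[OF residual_bottom[where c = "-4" and l = "-2" and h = 2, simplified]];
    (rule meets_across piece_intros | rule max.coboundedI1 | simp; fail)+)
  done

lemma f_ex_eq_sum_layers: "f_ex p = max 0 (layer_e p) + max 0 (layer_d p) + max 0 (layer_o p)"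
proof -
  have "max (max 0 (layer_e p)) (ridges_d p) - max 0 (layer_e p) = max 0 (layer_d p)"
    "max (max 0 (max (layer_e p) (ridges_d p))) (ridges_o p) - max 0 (max (layer_e p) (ridges_d p)) = max 0 (layer_o p)"
    using residual_ridges_d residual_ridges_o unfolding residual_def by blast+
  then show ?thesis
    unfolding f_ex_eq_max_layers by (simp only: max.assoc[symmetric])
qed

section \<open>Summands and cycles\<close>

lemma unimodal_nonneg: "unimodal u \<Longrightarrow> 0 \<le> u p"
  unfolding unimodal_def by blast

lemma unimodal_superlevel:
  assumes "unimodal u" "0 < c"
  shows "u -` {c..} = {} \<or> contractible (u -` {c..})" "closed (u -` {c..})"
proof -
  obtain M where "\<forall>c. 0 < c \<and> c \<le> M \<longrightarrow> u -` {c..} \<noteq> {} \<and> contractible (u -` {c..})"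
      "\<forall>c>M. u -` {c..} = {}"
    using assms(1) unfolding unimodal_def by blast
  then show "u -` {c..} = {} \<or> contractible (u -` {c..})"
    using assms(2) by (meson not_le)
  show "closed (u -` {c..})"
    using assms(1) unfolding unimodal_def by (intro closed_vimage) auto
qed

lemma connected_superlevel:
  fixes u :: "'a::real_normed_vector \<Rightarrow> real"
  assumes "unimodal u" "0 < c"
  shows "connected (u -` {c..})"
  using unimodal_superlevel(1)[OF assms]
  by (auto intro: contractible_imp_path_connected path_connected_imp_connected)

text \<open>
  By Borsuk's criterion a compact set does not separate if all its maps to the sphere are
  inessential, which is clear for contractible sets.
\<close>

lemma connected_Compl_contractible:
  fixes S :: "'a::euclidean_space set"
  assumes "compact S" "contractible S" "2 \<le> DIM('a)"
  shows "connected (- S)"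
  unfolding Borsuk_separation_theorem[OF assms(1,3)]
  using nullhomotopic_from_contractible[OF _ _ assms(2)] by metis

text \<open>
  The key obstruction. If \<open>u\<close> stays below 1 on the frontier of \<open>U\<close>, then by compactness \<open>v\<close> is
  bounded below by some \<open>1 - c > 0\<close> there. That superlevel set of \<open>v\<close> is compact and contractible, so
  its complement is connected; but the complement contains the hole \<open>h\<close> and points outside \<open>U\<close>
  without meeting the frontier.
\<close>

lemma frontier_meets_superlevel:
  fixes u v f :: "'a::euclidean_space \<Rightarrow> real"
  assumes dim: "2 \<le> DIM('a)" and u: "unimodal u" and v: "unimodal v"
    and f: "\<And>p. f p = u p + v p" and supp: "bounded {p. 0 < f p}"
    and U: "bounded U" and fr: "\<And>p. p \<in> frontier U \<Longrightarrow> 1 \<le> f p"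
    and h: "h \<in> U" "f h = 0"
  shows "frontier U \<inter> u -` {1..} \<noteq> {}"
proof
  assume none: "frontier U \<inter> u -` {1..} = {}"
  have nonneg: "0 \<le> u p" "0 \<le> v p" for p using u v unfolding unimodal_def by blast+
  \<comment> \<open>an empty frontier has no maximum, but then any \<open>c\<close> will do\<close>
  obtain c where c: "c < 1" "\<And>p. p \<in> frontier U \<Longrightarrow> u p \<le> c"
  proof (cases "frontier U = {}")
    case True
    then show ?thesis using that[of 0] by simp
  next
    case False
    have "compact (frontier U)" using U by (rule compact_frontier_bounded)
    moreover have "continuous_on (frontier U) u"
      using u unfolding unimodal_def by (meson continuous_on_subset subset_UNIV)
    ultimately obtain q where "q \<in> frontier U" "\<forall>p\<in>frontier U. u p \<le> u q"
      using False continuous_attains_sup by blast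
    then show ?thesis using none that[of "u q"] by force
  qed
  define B where "B = v -` {1 - c..}"
  have lvl: "B = {} \<or> contractible B" "closed B"
    unfolding B_def using unimodal_superlevel[OF v, of "1 - c"] c by auto
  have "B \<subseteq> {p. 0 < f p}"
  proof
    fix p assume "p \<in> B"
    then show "p \<in> {p. 0 < f p}" using c(1) nonneg[of p] f[of p] by (simp add: B_def)
  qed
  then have "bounded B" using supp by (rule bounded_subset[rotated])
  then have conn: "connected (- B)"
    using lvl connected_Compl_contractible[OF _ _ dim, of B] by (auto simp: compact_eq_bounded_closed)
  have "h \<notin> B" using h nonneg[of h] f[of h] c by (simp add: B_def)
  moreover have "- B - U \<noteq> {}"
  proof
    assume "- B - U = {}"
    then have "B \<union> U = UNIV" by blast
    then show False using \<open>bounded B\<close> U not_bounded_UNIV by (metis bounded_Un)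
  qed
  ultimately obtain p where "p \<in> - B" "p \<in> frontier U"
    using connected_Int_frontier[OF conn, of U] h by blast
  then show False using c(2)[of p] fr[of p] f[of p] by (simp add: B_def)
qed

lemma frontier_open_subset:
  assumes "open G" "closed C" "G \<subseteq> C"
  shows "frontier G \<subseteq> C - G"
  using assms unfolding frontier_def by (metis Diff_mono closure_minimal interior_open order_refl)

section \<open>Values on and off the graph\<close>

lemma f_ex_supp: "bounded {p. 0 < f_ex p}"
proof -
  have "{p. 0 < f_ex p} \<subseteq> cbox (-7, -7) (7, 7)"
  proof
    fix p assume "p \<in> {p. 0 < f_ex p}"
    then have "-7 \<le> fst p \<and> fst p \<le> 7 \<and> -7 \<le> snd p \<and> snd p \<le> 7"
      unfolding mem_Collect_eq f_ex_ridges less_max_iff_disj spike_greater ridge_def min_less_iff_conj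
      by (elim disjE) auto
    then show "p \<in> cbox (-7, -7) (7, 7)" by (cases p) auto
  qed
  then show ?thesis by (rule bounded_subset[OF bounded_cbox])
qed

text \<open>
  The second condition keeps \<open>p\<close> away from the parts of the two spikes above level 1.
\<close>

lemma f_ex_eq_1:
  assumes "p \<in> K_set" "\<bar>fst p\<bar> \<le> 3 \<or> 5 \<le> \<bar>fst p\<bar> \<or> 1 \<le> \<bar>snd p\<bar>"
  shows "f_ex p = 1"
proof (rule order.antisym)
  have "\<not> 1 < spike a p" if "\<bar>a\<bar> = 4" for a
    unfolding spike_greater using assms(2) that by linarith
  then have "spike (-4) p \<le> 1" "spike 4 p \<le> 1" by (simp_all add: not_less)
  then show "f_ex p \<le> 1"
    unfolding f_ex_ridges by (intro max.boundedI ridge_le_1) auto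
  show "1 \<le> f_ex p"
    using assms(1)
    unfolding K_set_boxes Un_iff f_ex_ridges le_max_iff_disj ridge_ge_1
    by (elim disjE) (simp_all only: simp_thms)
qed

lemma f_ex_eq_0:
  assumes "spike (-4) p \<le> 0" "spike 4 p \<le> 0"
    "ridge (-4) 4 0 0 p \<le> 0" "ridge (-6) (-6) (-6) 6 p \<le> 0" "ridge 0 0 (-6) 6 p \<le> 0"
    "ridge (-6) 0 (-6) (-6) p \<le> 0" "ridge (-6) 0 6 6 p \<le> 0" "ridge (-2) (-2) (-4) 4 p \<le> 0"
    "ridge 2 2 (-4) 4 p \<le> 0" "ridge (-2) 2 (-4) (-4) p \<le> 0" "ridge (-2) 2 4 4 p \<le> 0"
  shows "f_ex p = 0"
  unfolding f_ex_ridges using assms by (intro max.absorb1 max.boundedI)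

lemma f_ex_peaks: "f_ex (4, 0) = 3" "f_ex (-4, 0) = 3"
proof -
  have "f_ex (a, 0) = 3" if "\<bar>a\<bar> = 4" for a
  proof (rule order.antisym)
    have *: "ridge a' b' l' h' p \<le> 3" "spike a' p \<le> 3" for a' b' l' h' p
      using ridge_le_1[of a' b' l' h' p] by (auto simp: spike_def)
    show "f_ex (a, 0) \<le> 3" unfolding f_ex_ridges by (intro max.boundedI *) simp
    have "a = 4 \<or> a = -4" using that by linarith
    then show "3 \<le> f_ex (a, 0)"
      unfolding f_ex_ridges le_max_iff_disj by (auto simp: spike_def)
  qed
  from this[of 4] this[of "-4"] show "f_ex (4, 0) = 3" "f_ex (-4, 0) = 3" by simp_all
qed

lemma f_ex_axis_le_1: "f_ex (0, y) \<le> 1"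
  unfolding f_ex_ridges by (intro max.boundedI ridge_le_1) (auto simp: spike_def)

lemma K_set_grid:
  assumes "\<bar>x\<bar> \<le> 2" "\<bar>y\<bar> \<le> 4" "x = 0 \<or> \<bar>x\<bar> = 2 \<or> y = 0 \<or> \<bar>y\<bar> = 4"
  shows "(x, y) \<in> K_set"
proof -
  have xy: "-2 \<le> x" "x \<le> 2" "-4 \<le> y" "y \<le> 4" using assms(1,2) by linarith+
  consider "x = 0" | "x = 2" | "x = -2" | "y = 0" | "y = 4" | "y = -4" using assms(3) by linarith
  then show ?thesis by cases (use xy in \<open>simp_all add: K_set_def\<close>)
qed

text \<open>
  A superset of \<open>{f \<ge> 1}\<close> that is symmetric about both axes: it adds the mirror image of the arc and
  prolongs the lines carrying the arc and its mirror image. The cells below have no boundary points on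
  the additions, and the symmetry allows the four triangles and the two leaves to be treated by sign
  parameters.
\<close>

definition frame :: "(real \<times> real) set" where
  "frame = {(x, y). x = 0 \<or> \<bar>x\<bar> = 6 \<or> \<bar>y\<bar> = 6 \<or> y = 0 \<and> \<bar>x\<bar> \<le> 4 \<or>
     \<bar>x\<bar> = 2 \<and> \<bar>y\<bar> \<le> 4 \<or> \<bar>y\<bar> = 4 \<and> \<bar>x\<bar> \<le> 2 \<or> 10/3 \<le> \<bar>x\<bar> \<and> \<bar>x\<bar> \<le> 14/3 \<and> \<bar>y\<bar> \<le> 2/3}"

lemma frame_reflect: "\<bar>s\<bar> = 1 \<Longrightarrow> \<bar>t\<bar> = 1 \<Longrightarrow> (s * x, t * y) \<in> frame \<longleftrightarrow> (x, y) \<in> frame"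
  unfolding frame_def by (auto simp: abs_mult)

lemma f_ex_ge_1_imp_frame:
  assumes "1 \<le> f_ex p"
  shows "p \<in> frame"
proof -
  obtain x y where p: "p = (x, y)" by force
  have S: "p \<in> frame" if "\<bar>x - a\<bar> \<le> 2/3 \<and> \<bar>y\<bar> \<le> 2/3" "\<bar>a\<bar> = 4" for a
  proof -
    have "10/3 \<le> \<bar>x\<bar>" "\<bar>x\<bar> \<le> 14/3" using that by linarith+
    then show ?thesis using that by (simp add: frame_def p)
  qed
  show ?thesis
    using assms S[of 4] S[of "-4"]
    unfolding f_ex_ridges le_max_iff_disj spike_ge ridge_ge_1 mem_Times_iff p fst_conv snd_conv
    by (elim disjE) (auto simp: frame_def)
qed

section \<open>Cells cut out at branch points\<close>

text \<open>
  Three kinds of open cells, for signs \<open>s\<close> and \<open>t\<close>: around the leaf edge at \<open>s\<close>, around the part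
  of the rectangle and its axes that contains this leaf, and around a triangle. Their boundary lines
  are slanted so that they cross the graph only at branch points: at each such point some of the edges
  start inside the cell and the others outside.
\<close>

definition leg_cell :: "real \<Rightarrow> (real \<times> real) set" where
  "leg_cell s = {(x, y). s * x < 5 \<and> \<bar>y\<bar> + 2 < s * x \<and> \<bar>y\<bar> < 1}"

definition side_cell :: "real \<Rightarrow> (real \<times> real) set" where
  "side_cell s = {(x, y). s * x < 5 \<and> \<bar>y\<bar> - 2 * (s * x) < 4 \<and> \<bar>y\<bar> < 5}"

definition window_cell :: "real \<Rightarrow> real \<Rightarrow> (real \<times> real) set" where
  "window_cell s t = {(x, y). 0 < s * x + t * y \<and> s * x - t * y < 2 \<and> -4 < s * x - t * y \<and>
     -1 < s * x \<and> s * x < 3 \<and> t * y < 5}"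

text \<open>
  The boundaries of the three cells, intersected with the frame; \<open>X\<close> and \<open>Y\<close> stand for
  \<open>s * x\<close> and \<open>t * y\<close>.
\<close>

lemma frame_leg_cell_boundary:
  fixes X Y :: real
  assumes "(X, Y) \<in> frame" "X \<le> 5" "\<bar>Y\<bar> + 2 \<le> X" "\<bar>Y\<bar> \<le> 1" "\<not> (X < 5 \<and> \<bar>Y\<bar> + 2 < X \<and> \<bar>Y\<bar> < 1)"
  shows "X = 2 \<and> Y = 0"
  using assms unfolding frame_def mem_Collect_eq case_prod_conv
  by (elim disjE conjE) (auto simp: abs_if split: if_splits)

lemma frame_side_cell_boundary:
  fixes X Y :: real
  assumes "(X, Y) \<in> frame" "X \<le> 5" "\<bar>Y\<bar> - 2 * X \<le> 4" "\<bar>Y\<bar> \<le> 5" "\<not> (X < 5 \<and> \<bar>Y\<bar> - 2 * X < 4 \<and> \<bar>Y\<bar> < 5)"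
  shows "X = 0 \<and> (Y = 4 \<or> Y = -4) \<or> X = -2 \<and> Y = 0"
  using assms unfolding frame_def mem_Collect_eq case_prod_conv
  by (elim disjE conjE) (auto simp: abs_if split: if_splits)

lemma frame_window_cell_boundary:
  fixes X Y :: real
  assumes "(X, Y) \<in> frame" "0 \<le> X + Y" "X - Y \<le> 2" "-4 \<le> X - Y" "-1 \<le> X" "X \<le> 3" "Y \<le> 5"
    "\<not> (0 < X + Y \<and> X - Y < 2 \<and> -4 < X - Y \<and> -1 < X \<and> X < 3 \<and> Y < 5)"
  shows "X = 0 \<and> Y = 0 \<or> X = 2 \<and> Y = 0 \<or> X = 0 \<and> Y = 4"
  using assms unfolding frame_def mem_Collect_eq case_prod_conv
  by (elim disjE conjE) (auto simp: abs_if split: if_splits)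

lemma frontier_leg_cell:
  assumes "\<bar>s\<bar> = 1" "p \<in> frontier (leg_cell s)" "p \<in> frame"
  shows "p = (2 * s, 0)"
proof -
  obtain x y where p: "p = (x, y)" by force
  let ?C = "{(x, y). s * x \<le> 5 \<and> \<bar>y\<bar> + 2 \<le> s * x \<and> \<bar>y\<bar> \<le> 1}"
  have "frontier (leg_cell s) \<subseteq> ?C - leg_cell s"
    unfolding leg_cell_def case_prod_beta
    by (intro frontier_open_subset open_Collect_conj closed_Collect_conj open_Collect_less
        closed_Collect_le continuous_intros) auto
  then have mem: "p \<in> ?C - leg_cell s" using assms(2) by (rule subsetD)
  have "(s * x, y) \<in> frame" using assms frame_reflect[of s 1 x y] by (simp add: p)
  then have "s * x = 2 \<and> y = 0"
    using mem unfolding p leg_cell_def by (intro frame_leg_cell_boundary) simp_all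
  moreover have "s = 1 \<or> s = -1" using assms(1) by linarith
  ultimately show ?thesis unfolding p by auto
qed

lemma frontier_side_cell:
  assumes "\<bar>s\<bar> = 1" "p \<in> frontier (side_cell s)" "p \<in> frame"
  shows "p \<in> {(0, 4), (0, -4), (-2 * s, 0)}"
proof -
  obtain x y where p: "p = (x, y)" by force
  let ?C = "{(x, y). s * x \<le> 5 \<and> \<bar>y\<bar> - 2 * (s * x) \<le> 4 \<and> \<bar>y\<bar> \<le> 5}"
  have "frontier (side_cell s) \<subseteq> ?C - side_cell s"
    unfolding side_cell_def case_prod_beta
    by (intro frontier_open_subset open_Collect_conj closed_Collect_conj open_Collect_less
        closed_Collect_le continuous_intros) auto
  then have mem: "p \<in> ?C - side_cell s" using assms(2) by (rule subsetD)
  have "(s * x, y) \<in> frame" using assms frame_reflect[of s 1 x y] by (simp add: p)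
  then have "s * x = 0 \<and> (y = 4 \<or> y = -4) \<or> s * x = -2 \<and> y = 0"
    using mem unfolding p side_cell_def by (intro frame_side_cell_boundary) simp_all
  moreover have "s = 1 \<or> s = -1" using assms(1) by linarith
  ultimately show ?thesis unfolding p by auto
qed

lemma frontier_window_cell:
  assumes "\<bar>s\<bar> = 1" "\<bar>t\<bar> = 1" "p \<in> frontier (window_cell s t)" "p \<in> frame"
  shows "p \<in> {(0, 0), (2 * s, 0), (0, 4 * t)}"
proof -
  obtain x y where p: "p = (x, y)" by force
  let ?C = "{(x, y). 0 \<le> s * x + t * y \<and> s * x - t * y \<le> 2 \<and> -4 \<le> s * x - t * y \<and>
     -1 \<le> s * x \<and> s * x \<le> 3 \<and> t * y \<le> 5}"
  have "frontier (window_cell s t) \<subseteq> ?C - window_cell s t"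
    unfolding window_cell_def case_prod_beta
    by (intro frontier_open_subset open_Collect_conj closed_Collect_conj open_Collect_less
        closed_Collect_le continuous_intros) auto
  then have mem: "p \<in> ?C - window_cell s t" using assms(3) by (rule subsetD)
  have "(s * x, t * y) \<in> frame" using assms frame_reflect[of s t x y] by (simp add: p)
  then have "s * x = 0 \<and> t * y = 0 \<or> s * x = 2 \<and> t * y = 0 \<or> s * x = 0 \<and> t * y = 4"
    using mem unfolding p window_cell_def by (intro frame_window_cell_boundary) simp_all
  moreover have "s = 1 \<or> s = -1" "t = 1 \<or> t = -1" using assms(1,2) by linarith+
  ultimately show ?thesis unfolding p by auto
qed

section \<open>Cycles around holes\<close>

text \<open>
  One of the four quarters of the rectangle; its boundary is a triangle of the graph with \<open>O\<close> as one
  of its branch points.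
\<close>

definition window :: "real \<Rightarrow> real \<Rightarrow> (real \<times> real) set" where
  "window s t = {(x, y). 0 < s * x \<and> s * x < 2 \<and> 0 < t * y \<and> t * y < 4}"

lemma frontier_window:
  assumes "\<bar>s\<bar> = 1" "\<bar>t\<bar> = 1" "p \<in> frontier (window s t)"
  shows "f_ex p = 1" "p \<in> window_cell s t \<union> {(0, 0), (2 * s, 0), (0, 4 * t)}" "\<bar>r\<bar> = 1 \<Longrightarrow> p \<notin> leg_cell r"
proof -
  obtain x y where p: "p = (x, y)" by force
  let ?C = "{(x, y). 0 \<le> s * x \<and> s * x \<le> 2 \<and> 0 \<le> t * y \<and> t * y \<le> 4}"
  have "frontier (window s t) \<subseteq> ?C - window s t"
    unfolding window_def case_prod_beta
    by (intro frontier_open_subset open_Collect_conj closed_Collect_conj open_Collect_less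
        closed_Collect_le continuous_intros) auto
  then have mem: "p \<in> ?C - window s t" using assms(3) by (rule subsetD)
  then have *: "0 \<le> s * x" "s * x \<le> 2" "0 \<le> t * y" "t * y \<le> 4" "s * x = 0 \<or> s * x = 2 \<or> t * y = 0 \<or> t * y = 4"
    using mem unfolding p window_def by auto
  have eq: "s * x = \<bar>x\<bar>" "t * y = \<bar>y\<bar>"
    using *(1,3) assms(1,2) by (metis abs_mult abs_of_nonneg mult_1)+
  have "p \<in> K_set" unfolding p by (rule K_set_grid) (use * in \<open>simp_all add: eq\<close>)
  moreover have "\<bar>fst p\<bar> \<le> 3" using * unfolding p eq by simp
  ultimately show "f_ex p = 1" by (intro f_ex_eq_1) auto
  have "s = 1 \<or> s = -1" "t = 1 \<or> t = -1" using assms(1,2) by linarith+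
  then have inv: "s * x = 0 \<Longrightarrow> x = 0" "s * x = 2 \<Longrightarrow> x = 2 * s" "t * y = 0 \<Longrightarrow> y = 0"
    "t * y = 4 \<Longrightarrow> y = 4 * t" by auto
  consider "s * x = 0" "t * y = 0" | "s * x = 2" "t * y = 0" | "s * x = 0" "t * y = 4"
    | "0 < s * x + t * y" "s * x - t * y < 2" "-4 < s * x - t * y"
    using * by linarith
  then show "p \<in> window_cell s t \<union> {(0, 0), (2 * s, 0), (0, 4 * t)}"
  proof cases
    case 4
    moreover have "-1 < s * x" "s * x < 3" "t * y < 5" using * by linarith+
    ultimately show ?thesis unfolding p window_cell_def by simp
  qed (use inv in \<open>simp_all add: p\<close>)
  have "r * x \<le> \<bar>x\<bar>" if "\<bar>r\<bar> = 1"
    using abs_ge_self[of "r * x"] that by (simp add: abs_mult)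
  then show "p \<notin> leg_cell r" if "\<bar>r\<bar> = 1"
    using that *(2) unfolding p leg_cell_def eq by auto
qed

lemma bounded_window: "\<bar>s\<bar> = 1 \<Longrightarrow> \<bar>t\<bar> = 1 \<Longrightarrow> bounded (window s t)"
  by (rule bounded_subset[OF bounded_cbox[of "(-4, -4)" "(4, 4)"]])
    (auto simp: window_def abs_if split: if_splits)

lemma f_ex_window:
  assumes "\<bar>s\<bar> = 1" "\<bar>t\<bar> = 1"
  shows "f_ex (s, 2 * t) = 0"
proof -
  have "s = 1 \<or> s = -1" "t = 1 \<or> t = -1" using assms(1,2) by linarith+
  then show ?thesis
    by (elim disjE; hypsubst; intro f_ex_eq_0) (simp_all add: spike_def ridge_def)
qed

text \<open>
  The two remaining cycles are boundaries of regions built from the two rectangles of the graph: the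
  union of the boxes is bounded by \<open>L N E S\<close>, and the left box without the inner one by
  \<open>L N W S\<close>.
\<close>

definition left_box :: "(real \<times> real) set" where
  "left_box = {(x, y). -6 < x \<and> x < 0 \<and> -6 < y \<and> y < 6}"

definition inner_box :: "(real \<times> real) set" where
  "inner_box = {(x, y). -2 < x \<and> x < 2 \<and> -4 < y \<and> y < 4}"

lemma closure_inner_box: "closure inner_box = {-2..2} \<times> {-4..4}"
proof -
  have "inner_box = {-2<..<2} \<times> {-4<..<4}" by (auto simp: inner_box_def)
  moreover have "closure ({-2<..<2} \<times> {-4<..<4}) = {-2..2 :: real} \<times> {-4..4 :: real}"
    by (simp add: closure_Times)
  ultimately show ?thesis by (simp only:)
qed

lemma bounded_boxes: "bounded left_box" "bounded inner_box"
  by (rule bounded_subset[OF bounded_cbox[of "(-6, -6)" "(6, 6)"]]; auto simp: left_box_def inner_box_def)+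

lemma f_ex_hole: "f_ex (-4, 3) = 0"
  by (intro f_ex_eq_0) (simp_all add: spike_def ridge_def)

lemma frontier_left_Un_inner:
  assumes "p \<in> frontier (left_box \<union> inner_box)"
  shows "f_ex p = 1" "p \<notin> side_cell (-1)"
proof -
  obtain x y where p: "p = (x, y)" by force
  let ?C = "({(x, y). -6 \<le> x \<and> x \<le> 0 \<and> -6 \<le> y \<and> y \<le> 6} \<union>
      {(x, y). -2 \<le> x \<and> x \<le> 2 \<and> -4 \<le> y \<and> y \<le> 4})"
  have "frontier (left_box \<union> inner_box) \<subseteq> ?C - (left_box \<union> inner_box)"
    unfolding left_box_def inner_box_def case_prod_beta
    by (intro frontier_open_subset open_Un closed_Un open_Collect_conj closed_Collect_conj
        open_Collect_less closed_Collect_le continuous_intros) auto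
  then have mem: "p \<in> ?C - (left_box \<union> inner_box)" using assms(1) by (rule subsetD)
  then have "(-6 \<le> x \<and> x \<le> 0 \<and> -6 \<le> y \<and> y \<le> 6) \<or> (-2 \<le> x \<and> x \<le> 2 \<and> -4 \<le> y \<and> y \<le> 4)"
    "\<not> (-6 < x \<and> x < 0 \<and> -6 < y \<and> y < 6)" "\<not> (-2 < x \<and> x < 2 \<and> -4 < y \<and> y < 4)"
    using mem unfolding p left_box_def inner_box_def by auto
  then have *: "x = -6 \<and> \<bar>y\<bar> \<le> 6 \<or> -6 \<le> x \<and> x \<le> 0 \<and> \<bar>y\<bar> = 6 \<or> x = 0 \<and> 4 \<le> \<bar>y\<bar> \<and> \<bar>y\<bar> \<le> 6 \<or>
      x = 2 \<and> \<bar>y\<bar> \<le> 4 \<or> 0 \<le> x \<and> x \<le> 2 \<and> \<bar>y\<bar> = 4"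
    by argo
  then have "p \<in> K_set"
  proof (elim disjE conjE)
    assume "x = 2" "\<bar>y\<bar> \<le> 4"
    then show ?thesis unfolding p by (intro K_set_grid) auto
  next
    assume "0 \<le> x" "x \<le> 2" "\<bar>y\<bar> = 4"
    then show ?thesis unfolding p by (intro K_set_grid) auto
  qed (auto simp: p K_set_def abs_le_iff abs_eq_iff)
  moreover have "\<bar>fst p\<bar> \<le> 3 \<or> 5 \<le> \<bar>fst p\<bar> \<or> 1 \<le> \<bar>snd p\<bar>"
    using * unfolding p by auto
  ultimately show "f_ex p = 1" by (rule f_ex_eq_1)
  show "p \<notin> side_cell (-1)" using * unfolding p side_cell_def by auto
qed

lemma frontier_left_minus_inner:
  assumes "p \<in> frontier (left_box - closure inner_box)"
  shows "f_ex p = 1" "p \<notin> side_cell 1"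
proof -
  obtain x y where p: "p = (x, y)" by force
  have cl': "closure inner_box = {(x, y). -2 \<le> x \<and> x \<le> 2 \<and> -4 \<le> y \<and> y \<le> 4}"
    unfolding closure_inner_box by auto
  let ?C = "{(x, y). -6 \<le> x \<and> x \<le> 0 \<and> -6 \<le> y \<and> y \<le> 6} - inner_box"
  have "frontier (left_box - closure inner_box) \<subseteq> ?C - (left_box - closure inner_box)"
    unfolding cl' unfolding left_box_def inner_box_def case_prod_beta
    by (intro frontier_open_subset open_Diff closed_Diff open_Collect_conj closed_Collect_conj
        open_Collect_less closed_Collect_le continuous_intros) auto
  then have "p \<in> ?C - (left_box - closure inner_box)" using assms by (rule subsetD)
  then have "-6 \<le> x \<and> x \<le> 0 \<and> -6 \<le> y \<and> y \<le> 6" "\<not> (-2 < x \<and> x < 2 \<and> -4 < y \<and> y < 4)"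
    "\<not> (-6 < x \<and> x < 0 \<and> -6 < y \<and> y < 6) \<or> -2 \<le> x \<and> x \<le> 2 \<and> -4 \<le> y \<and> y \<le> 4"
    unfolding cl' unfolding p left_box_def inner_box_def by auto
  then have *: "x = -6 \<and> \<bar>y\<bar> \<le> 6 \<or> -6 \<le> x \<and> x \<le> 0 \<and> \<bar>y\<bar> = 6 \<or> x = 0 \<and> 4 \<le> \<bar>y\<bar> \<and> \<bar>y\<bar> \<le> 6 \<or>
      x = -2 \<and> \<bar>y\<bar> \<le> 4 \<or> -2 \<le> x \<and> x \<le> 0 \<and> \<bar>y\<bar> = 4"
    by argo
  then have "p \<in> K_set"
  proof (elim disjE conjE)
    assume "x = -2" "\<bar>y\<bar> \<le> 4"
    then show ?thesis unfolding p by (intro K_set_grid) auto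
  next
    assume "-2 \<le> x" "x \<le> 0" "\<bar>y\<bar> = 4"
    then show ?thesis unfolding p by (intro K_set_grid) auto
  qed (auto simp: p K_set_def abs_le_iff abs_eq_iff)
  moreover have "\<bar>fst p\<bar> \<le> 3 \<or> 5 \<le> \<bar>fst p\<bar> \<or> 1 \<le> \<bar>snd p\<bar>"
    using * unfolding p by auto
  ultimately show "f_ex p = 1" by (rule f_ex_eq_1)
  show "p \<notin> side_cell 1" using * unfolding p side_cell_def by auto
qed

section \<open>Two summands do not suffice\<close>

text \<open>
  A connected set in \<open>{f \<ge> 1}\<close> can leave a cell only through a branch point on its boundary.
\<close>

lemma connected_passes:
  assumes "connected C" "\<And>p. p \<in> C \<Longrightarrow> 1 \<le> f_ex p" "\<And>p. p \<in> frontier G \<Longrightarrow> p \<in> frame \<Longrightarrow> p \<in> V"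
    "a \<in> C" "a \<in> G" "b \<in> C" "b \<notin> G"
  shows "C \<inter> V \<noteq> {}"
proof -
  have "C \<inter> frontier G \<noteq> {}" using assms(1,4-7) by (intro connected_Int_frontier) blast+
  then obtain p where p: "p \<in> C" "p \<in> frontier G" by blast
  then have "p \<in> V" using assms(2,3) f_ex_ge_1_imp_frame by blast
  then show ?thesis using p(1) by blast
qed

text \<open>
  The leaf at \<open>(4 * s, 0)\<close> is taken as the one where the summand \<open>u\<close> has its peak, so that the cycles
  that \<open>C\<close> has to reach are those on the far side: two windows, and one of the two large cycles.
\<close>

lemma summand_passes:
  assumes u: "unimodal u" and v: "unimodal v" and f: "\<And>p. f_ex p = u p + v p"
    and s: "\<bar>s\<bar> = 1" and peak: "1 < u (4 * s, 0)"
  defines "C \<equiv> u -` {1..}"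
  shows "(2 * s, 0) \<in> C"
    and "(0, 0) \<in> C \<or> (-2 * s, 0) \<in> C \<or> (0, 4) \<in> C \<and> (0, -4) \<in> C"
    and "(0, 4) \<in> C \<or> (0, -4) \<in> C \<or> (-2 * s, 0) \<in> C"
proof -
  have conn: "connected C" unfolding C_def using u by (rule connected_superlevel) simp
  have lvl: "1 \<le> f_ex p" if "p \<in> C" for p
    using that unimodal_nonneg[OF v, of p] f[of p] by (simp add: C_def)
  have reach: "frontier U \<inter> C \<noteq> {}"
    if "bounded U" "\<And>p. p \<in> frontier U \<Longrightarrow> 1 \<le> f_ex p" "h \<in> U" "f_ex h = 0" for U h
    unfolding C_def by (rule frontier_meets_superlevel[OF _ u v f f_ex_supp that]) simp_all
  have peak_C: "(4 * s, 0) \<in> C" using peak by (simp add: C_def)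
  have sq: "r * r = 1" if "\<bar>r\<bar> = 1" for r :: real using that by (metis abs_mult_self_eq mult_1)
  note ss = sq[OF s]
  \<comment> \<open>the holes of the two triangles on the far side\<close>
  have win: "\<exists>q. q \<in> frontier (window (-s) t) \<and> q \<in> C" if t: "\<bar>t\<bar> = 1" for t
  proof -
    have "(-s, 2 * t) \<in> window (-s) t" using sq[OF t] ss by (simp add: window_def)
    moreover have "f_ex (-s, 2 * t) = 0" using f_ex_window[of "-s" t] s t by simp
    ultimately have "frontier (window (-s) t) \<inter> C \<noteq> {}"
      using s t frontier_window(1)[of "-s" t] by (intro reach[of _ "(-s, 2 * t)"] bounded_window) auto
    then show ?thesis by blast
  qed
  show "(2 * s, 0) \<in> C"
  proof -
    obtain q where q: "q \<in> frontier (window (-s) 1)" "q \<in> C" using win[of 1] by auto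
    have "C \<inter> {(2 * s, 0)} \<noteq> {}"
    proof (rule connected_passes[OF conn lvl _ peak_C _ q(2)])
      show "(4 * s, 0) \<in> leg_cell s" using ss by (simp add: leg_cell_def)
      show "q \<notin> leg_cell s" using frontier_window(3)[OF _ _ q(1)] s by simp
      show "p \<in> {(2 * s, 0)}" if "p \<in> frontier (leg_cell s)" "p \<in> frame" for p
        using frontier_leg_cell[OF s that] by simp
    qed
    then show ?thesis by simp
  qed
  have q: "(0, 0) \<in> C \<or> (-2 * s, 0) \<in> C \<or> (0, 4 * t) \<in> C" if t: "\<bar>t\<bar> = 1" for t
  proof -
    obtain q where q: "q \<in> frontier (window (-s) t)" "q \<in> C" using win[OF t] by auto
    have "q \<in> window_cell (-s) t \<union> {(0, 0), (2 * - s, 0), (0, 4 * t)}"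
      using frontier_window(2)[OF _ t q(1)] s by simp
    then consider "q \<in> window_cell (-s) t" | "q \<in> {(0, 0), (2 * - s, 0), (0, 4 * t)}" by blast
    then have "C \<inter> {(0, 0), (2 * - s, 0), (0, 4 * t)} \<noteq> {}"
    proof cases
      case 1
      have "(4 * s, 0) \<notin> window_cell (-s) t" using ss by (simp add: window_cell_def)
      then show ?thesis
        using frontier_window_cell[of "-s" t] s t
        by (intro connected_passes[OF conn lvl _ q(2) 1 peak_C]) simp_all
    qed (use q(2) in blast)
    then show ?thesis by auto
  qed
  show "(0, 0) \<in> C \<or> (-2 * s, 0) \<in> C \<or> (0, 4) \<in> C \<and> (0, -4) \<in> C"
    using q[of 1] q[of "-1"] by auto
  \<comment> \<open>the large cycle that avoids the branch point next to the leaf of \<open>u\<close>\<close>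
  obtain U h where U: "bounded U" "h \<in> U" "f_ex h = 0"
      "\<And>p. p \<in> frontier U \<Longrightarrow> f_ex p = 1 \<and> p \<notin> side_cell s"
  proof (cases "s = 1")
    case True
    have "(-4, 3) \<in> left_box - closure inner_box"
      by (simp add: closure_inner_box left_box_def)
    then show thesis
      using True bounded_boxes f_ex_hole frontier_left_minus_inner
      by (intro that[of "left_box - closure inner_box" "(-4, 3)"]) (auto intro: bounded_diff)
  next
    case False
    then have "s = -1" using s by linarith
    have "(-4, 3) \<in> left_box \<union> inner_box" by (simp add: left_box_def)
    then show thesis
      using \<open>s = -1\<close> bounded_boxes f_ex_hole frontier_left_Un_inner
      by (intro that[of "left_box \<union> inner_box" "(-4, 3)"]) auto
  qed
  have "frontier U \<inter> C \<noteq> {}"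
    using U by (intro reach[of U h]) auto
  then obtain r where r: "r \<in> frontier U" "r \<in> C" by blast
  have "C \<inter> {(0, 4), (0, -4), (-2 * s, 0)} \<noteq> {}"
  proof (rule connected_passes[OF conn lvl _ peak_C _ r(2)])
    show "(4 * s, 0) \<in> side_cell s" using ss by (simp add: side_cell_def)
    show "r \<notin> side_cell s" using U(4) r(1) by blast
    show "p \<in> {(0, 4), (0, -4), (-2 * s, 0)}" if "p \<in> frontier (side_cell s)" "p \<in> frame" for p
      using frontier_side_cell[OF s that] by simp
  qed
  then show "(0, 4) \<in> C \<or> (0, -4) \<in> C \<or> (-2 * s, 0) \<in> C" by auto
qed

text \<open>
  A connected superlevel set containing both leaves crosses the vertical axis, where the function is
  at most 1.
\<close>

lemma unimodal_not_two_spikes: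
  assumes u: "unimodal u" and le: "\<And>p. u p \<le> f_ex p"
  shows "u (4, 0) \<le> 1 \<or> u (-4, 0) \<le> 1"
proof (rule ccontr)
  assume "\<not> ?thesis"
  then have gt: "1 < u (4, 0)" "1 < u (-4, 0)" by auto
  define c where "c = min (u (4, 0)) (u (-4, 0))"
  have "1 < c" using gt by (simp add: c_def)
  have "connected (u -` {c..})" using u \<open>1 < c\<close> by (intro connected_superlevel) auto
  moreover have "(-4, 0) \<in> u -` {c..}" "(4, 0) \<in> u -` {c..}" by (auto simp: c_def)
  ultimately obtain p where p: "p \<in> u -` {c..}" "fst p = 0"
    using connected_ivt_hyperplane[of "u -` {c..}" "(-4, 0)" "(4, 0)" "(1, 0)" 0]
    by (auto simp: inner_prod_def)
  have "u p \<le> f_ex (0, snd p)" using le[of p] p(2) by (metis prod.collapse)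
  then show False using p(1) \<open>1 < c\<close> f_ex_axis_le_1[of "snd p"] by auto
qed

text \<open>
  The superlevel sets of \<open>u\<close> and \<open>v\<close> at level 1 are disjoint on branch points, where \<open>f_ex\<close> is 1;
  what remains of \<open>summand_passes\<close> is a propositional contradiction.
\<close>

lemma no_unimodal_pair_peak_d:
  assumes u: "unimodal u" and v: "unimodal v" and f: "\<And>p. f_ex p = u p + v p" and peak: "1 < u (-4, 0)"
  shows False
proof -
  have "u p \<le> f_ex p" for p using f[of p] unimodal_nonneg[OF v, of p] by simp
  then have "u (4, 0) \<le> 1"
    using unimodal_not_two_spikes[OF u] peak by force
  then have peak': "1 < v (4, 0)" using f[of "(4, 0)"] f_ex_peaks by simp
  have one: "f_ex p < 2" if "p \<in> {(0, 0), (2, 0), (-2, 0), (0, 4), (0, -4)}" for p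
  proof -
    have "f_ex p = 1"
      using that by (intro f_ex_eq_1) (auto simp: K_set_def)
    then show ?thesis by simp
  qed
  have f': "f_ex p = v p + u p" for p using f by simp
  have disj: "\<not> (p \<in> u -` {1..} \<and> p \<in> v -` {1..})" if "p \<in> {(0, 0), (2, 0), (-2, 0), (0, 4), (0, -4)}" for p
    using one[OF that] f[of p] by auto
  show False
    using summand_passes[OF u v f, of "-1"] summand_passes[OF v u f', of 1] peak peak'
      disj[of "(0, 0)"] disj[of "(2, 0)"] disj[of "(-2, 0)"] disj[of "(0, 4)"] disj[of "(0, -4)"]
    by simp blast
qed

lemma no_unimodal_pair:
  assumes u: "unimodal u" and v: "unimodal v" and f: "\<And>p. f_ex p = u p + v p"
  shows False
proof -
  have "1 < u (-4, 0) \<or> 1 < v (-4, 0)" using f[of "(-4, 0)"] f_ex_peaks by simp linarith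
  then show False
    using no_unimodal_pair_peak_d[OF u v f] no_unimodal_pair_peak_d[OF v u] f by (auto simp: add.commute)
qed

lemma not_unimodal_f_ex: "\<not> unimodal f_ex"
  using unimodal_not_two_spikes[of f_ex] f_ex_peaks by auto

section \<open>The unimodal categories\<close>

lemma ucat_f_ex: "ucat f_ex = 3"
  unfolding ucat_def
proof (rule order.antisym)
  let ?S = "{enat n | n. \<exists>u. (\<forall>i\<in>{1..n}. unimodal (u i)) \<and> (\<forall>x. f_ex x = (\<Sum>i=1..n. u i x))}"
  define u where "u i = (\<lambda>p. max 0 ((if i = 1 then layer_e else if i = 2 then layer_d else layer_o) p))" for i :: nat
  have "unimodal (u i)" for i
    using peaked_imp_unimodal[OF peaked_layer_e] peaked_imp_unimodal[OF peaked_layer_d]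
      peaked_imp_unimodal[OF peaked_layer_o] by (simp add: u_def)
  moreover have "f_ex p = (\<Sum>i=1..3. u i p)" for p
    by (simp add: f_ex_eq_sum_layers u_def eval_nat_numeral)
  ultimately have "enat 3 \<in> ?S" by blast
  then show "Inf ?S \<le> 3" by (simp add: Inf_lower numeral_eq_enat)
  show "3 \<le> Inf ?S"
  proof (rule Inf_greatest)
    fix m assume "m \<in> ?S"
    then obtain n u where m: "m = enat n" and u: "\<forall>i\<in>{1..n}. unimodal (u i)"
      and sum: "\<And>p. f_ex p = (\<Sum>i=1..n. u i p)" by blast
    have "n \<noteq> 0" using sum[of "(4, 0)"] f_ex_peaks by (intro notI) simp
    moreover have "n \<noteq> 1"
    proof
      assume "n = 1"
      then have "f_ex = u 1" using sum by auto
      then show False using u \<open>n = 1\<close> not_unimodal_f_ex by simp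
    qed
    moreover have "n \<noteq> 2"
    proof
      assume "n = 2"
      then have "f_ex p = u 1 p + u 2 p" for p using sum by (simp add: eval_nat_numeral)
      moreover have "unimodal (u 1)" "unimodal (u 2)" using u \<open>n = 2\<close> by simp_all
      ultimately show False using no_unimodal_pair by blast
    qed
    ultimately have "3 \<le> n" by linarith
    then show "3 \<le> m" by (simp add: m numeral_eq_enat)
  qed
qed

lemma ucat_infty_f_ex: "ucat_infty f_ex = 2"
  unfolding ucat_infty_def
proof (rule order.antisym)
  let ?S = "{enat n | n. \<exists>u. (\<forall>i\<in>{1..n}. unimodal (u i)) \<and>
      (\<forall>x. f_ex x = Max (insert 0 ((\<lambda>i. u i x) ` {1..n})))}"
  define u where "u i = (\<lambda>p. max 0 ((if i = 1 then tree_d else tree_e) p))" for i :: nat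
  have "unimodal (u i)" for i
    using peaked_imp_unimodal[OF peaked_tree_d] peaked_imp_unimodal[OF peaked_tree_e] by (simp add: u_def)
  moreover have "f_ex p = Max (insert 0 ((\<lambda>i. u i p) ` {1..2}))" for p
  proof -
    have "(\<lambda>i. u i p) ` {1..2} = {u 1 p, u 2 p}" by (auto simp: eval_nat_numeral le_Suc_eq)
    moreover have "max 0 (u 1 p) = u 1 p" by (simp add: u_def)
    ultimately show ?thesis by (simp add: f_ex_eq_max_trees u_def max.assoc[symmetric])
  qed
  ultimately have "enat 2 \<in> ?S" by blast
  then show "Inf ?S \<le> 2" by (simp add: Inf_lower numeral_eq_enat)
  show "2 \<le> Inf ?S"
  proof (rule Inf_greatest)
    fix m assume "m \<in> ?S"
    then obtain n u where m: "m = enat n" and u: "\<forall>i\<in>{1..n}. unimodal (u i)"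
      and Max: "\<And>p. f_ex p = Max (insert 0 ((\<lambda>i. u i p) ` {1..n}))" by blast
    have "n \<noteq> 0" using Max[of "(4, 0)"] f_ex_peaks by (intro notI) simp
    moreover have "n \<noteq> 1"
    proof
      assume "n = 1"
      then have "f_ex p = max 0 (u 1 p)" for p using Max by simp
      then have "f_ex = u 1" using unimodal_nonneg[of "u 1"] u \<open>n = 1\<close> by (auto simp: fun_eq_iff)
      then show False using u \<open>n = 1\<close> not_unimodal_f_ex by simp
    qed
    ultimately have "2 \<le> n" by linarith
    then show "2 \<le> m" by (simp add: m numeral_eq_enat)
  qed
qed

lemma ucat_pow_1: "ucat_pow 1 f = ucat f"
proof -
  have eq: "(\<Sum>i=1..n. u i x powr 1) powr (1 / 1) = (\<Sum>i=1..n. u i x)"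
    if "\<forall>i\<in>{1..n}. unimodal (u i)" for n :: nat and u :: "nat \<Rightarrow> 'a \<Rightarrow> real" and x
  proof -
    have nonneg: "0 \<le> u i x" if "i \<in> {1..n}" for i
      using that \<open>\<forall>i\<in>{1..n}. unimodal (u i)\<close> unimodal_nonneg by blast
    then have "0 \<le> (\<Sum>i=1..n. u i x)" by (rule sum_nonneg)
    moreover have "(\<Sum>i=1..n. u i x powr 1) = (\<Sum>i=1..n. u i x)"
      using nonneg by (intro sum.cong) auto
    ultimately show ?thesis by simp
  qed
  have "(\<exists>u. (\<forall>i\<in>{1..n}. unimodal (u i)) \<and> (\<forall>x. f x = (\<Sum>i=1..n. u i x powr 1) powr (1 / 1))) \<longleftrightarrow>
      (\<exists>u. (\<forall>i\<in>{1..n}. unimodal (u i)) \<and> (\<forall>x. f x = (\<Sum>i=1..n. u i x)))" for n :: nat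
    by (intro ex_cong1 conj_cong refl all_cong1) (simp only: eq)
  then show ?thesis
    unfolding ucat_pow_def ucat_def by simp
qed

theorem proposition4p16:
  shows "ucat_infty f_ex = 2 \<and> ucat f_ex = 3 \<and>
    \<not> (\<forall>p1 p2 :: ereal. 0 < p1 \<and> p1 < p2 \<and> p2 \<le> \<infinity> \<longrightarrow> ucat_ext p1 f_ex \<le> ucat_ext p2 f_ex)"
proof (intro conjI notI)
  show infty: "ucat_infty f_ex = 2" by (rule ucat_infty_f_ex)
  show sum: "ucat f_ex = 3" by (rule ucat_f_ex)
  assume "\<forall>p1 p2 :: ereal. 0 < p1 \<and> p1 < p2 \<and> p2 \<le> \<infinity> \<longrightarrow> ucat_ext p1 f_ex \<le> ucat_ext p2 f_ex"
  then have "ucat_ext 1 f_ex \<le> ucat_ext \<infinity> f_ex" by simp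
  then show False by (simp add: ucat_ext_def ucat_pow_1 infty sum)
qed

end
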